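(* Consider the $2$-vertex directed graph IFS on the unit interval described in the context (in which $d=b$), with attractors $F_u,F_v$; let $s=\dim_{\rm H}F_u=\dim_{\rm H}F_v$, $h_u=\mathcal{H}^s(F_u)$, $h_v=\mathcal{H}^s(F_v)$. Suppose that $$(1)\ |I_u|=|I_v|\ (\text{which holds automatically here, both being } 1),\qquad (2)\ \frac{h_v}{h_u}\leq 1,\qquad (3)\ \frac{(a+g_u)(1-a^s)}{b\,a^s}\geq 1$$ (so that $\mathcal{H}^s(F_u)=|I_u|^s=1$), and suppose that the set $\{g_u,g_v,a,b,c\}\subset\mathbb{R}^+$ is multiplicatively rationally independent. Then $F_u$ is not the attractor of any standard ($1$-vertex) IFS defined on $\mathbb{R}$, with or without separation conditions.
   Context: The $2$-vertex IFS on the unit interval with $b=d$: $I_u=I_v=[0,1]$, and $a,g_u,b,c,g_v>0$ satisfy $a+g_u+b=1$ and $c+g_v+b=1$. Define $S_{e_1}(x)=ax$, $S_{e_2}(x)=bx+a+g_u$, $S_{e_3}(x)=cx$, $S_{e_4}(x)=bx+c+g_v$ on $\mathbb{R}$. The attractors are the unique non-empty compact sets $F_u,F_v\subset\mathbb{R}$ with $F_u=S_{e_1}(F_u)\cup S_{e_2}(F_v)$ and $F_v=S_{e_3}(F_v)\cup S_{e_4}(F_u)$. (Known: $s$ is the unique non-negative real for which the matrix with rows $(a^s,b^s)$ and $(b^s,c^s)$ has spectral radius $1$, and $0<\mathcal{H}^s(F_u),\mathcal{H}^s(F_v)<+\infty$.) $\mathcal{H}^s$ is Hausdorff measure normalised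 using $\sum_i|U_i|^s$ over covers, with no additional constant. Multiplicatively rationally independent: a set $\{u_1,\dots,u_r\}$ of positive reals (listed as displayed) is multiplicatively rationally independent if for all integers $m_1,\dots,m_r$, $\prod_{i=1}^r u_i^{m_i}=1$ implies $m_i=0$ for all $i$. In particular the listed numbers are distinct. Standard ($1$-vertex) IFS on $\mathbb{R}$: a finite family $S_1,\dots,S_n$, $n\geq2$, of contracting similarities $S_i:\mathbb{R}\to\mathbb{R}$ (ratios in $(0,1)$, orientation reversal allowed); its attractor is the unique non-empty compact $F\subset\mathbb{R}$ with $F=\bigcup_{i=1}^nS_i(F)$. "With or without separation conditions" means no condition whatsoever is imposed on overlaps of the sets $S_i(F)$. *)

theory Defs
  imports "HOL-Analysis.Analysis"
begin

text \<open>
  The summand \<open>|U|\<^sup>s\<close>, with the usual conventions \<open>|{}|\<^sup>s = 0\<close> and \<open>|U|\<^sup>0 = 1\<close> for \<open>U \<noteq> {}\<close>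
  (note that \<open>0 powr 0 = 0\<close> in the library).
\<close>
definition diam_pow :: "real \<Rightarrow> 'a::metric_space set \<Rightarrow> ennreal" where
  "diam_pow s U = (if U = {} then 0 else if s = 0 then 1 else ennreal (diameter U powr s))"

text \<open>
  Boundedness is required explicitly because \<open>diameter\<close> is meaningless on unbounded sets.
  Finite covers are included, since the sets \<open>U i\<close> may be empty.
\<close>
definition delta_covers :: "real \<Rightarrow> 'a::metric_space set \<Rightarrow> (nat \<Rightarrow> 'a set) set" where
  "delta_covers \<delta> E = {U. E \<subseteq> (\<Union>i. U i) \<and> (\<forall>i. bounded (U i) \<and> diameter (U i) \<le> \<delta>)}"

definition hausdorff_premeasure :: "real \<Rightarrow> real \<Rightarrow> 'a::metric_space set \<Rightarrow> ennreal" where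
  "hausdorff_premeasure s \<delta> E = (INF U\<in>delta_covers \<delta> E. \<Sum>i. diam_pow s (U i))"

definition hausdorff_measure :: "real \<Rightarrow> 'a::metric_space set \<Rightarrow> ennreal" where
  "hausdorff_measure s E = (SUP \<delta>\<in>{0<..}. hausdorff_premeasure s \<delta> E)"

definition hausdorff_dim :: "'a::metric_space set \<Rightarrow> ennreal" where
  "hausdorff_dim E = (INF s\<in>{s. 0 \<le> s \<and> hausdorff_measure s E = 0}. ennreal s)"

definition contracting_similarity :: "('a::metric_space \<Rightarrow> 'a) \<Rightarrow> bool" where
  "contracting_similarity f \<longleftrightarrow>
     (\<exists>r. 0 < r \<and> r < 1 \<and> (\<forall>x y. dist (f x) (f y) = r * dist x y))"

definition standard_IFS :: "nat \<Rightarrow> (nat \<Rightarrow> real \<Rightarrow> real) \<Rightarrow> bool" where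
  "standard_IFS n S \<longleftrightarrow> 2 \<le> n \<and> (\<forall>i\<in>{1..n}. contracting_similarity (S i))"

text \<open>
  For a standard IFS, the non-empty compact set with this property exists and is unique
  (Hutchinson), so the predicate singles out the attractor.
\<close>
definition IFS_attractor :: "nat \<Rightarrow> (nat \<Rightarrow> real \<Rightarrow> real) \<Rightarrow> real set \<Rightarrow> bool" where
  "IFS_attractor n S F \<longleftrightarrow> F \<noteq> {} \<and> compact F \<and> F = (\<Union>i\<in>{1..n}. S i ` F)"

definition IFS2_params :: "real \<Rightarrow> real \<Rightarrow> real \<Rightarrow> real \<Rightarrow> real \<Rightarrow> bool" where
  "IFS2_params a g\<^sub>u b c g\<^sub>v \<longleftrightarrow>
     0 < a \<and> 0 < g\<^sub>u \<and> 0 < b \<and> 0 < c \<and> 0 < g\<^sub>v \<and> a + g\<^sub>u + b = 1 \<and> c + g\<^sub>v + b = 1"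

text \<open>
  The edges are \<open>e\<^sub>1 : u \<rightarrow> u\<close>, \<open>e\<^sub>2 : u \<rightarrow> v\<close>, \<open>e\<^sub>3 : v \<rightarrow> v\<close>, \<open>e\<^sub>4 : v \<rightarrow> u\<close>; both \<open>e\<^sub>2\<close> and \<open>e\<^sub>4\<close> have
  ratio \<open>b\<close>.
\<close>
definition S_e1 :: "real \<Rightarrow> real \<Rightarrow> real" where
  "S_e1 a x = a * x"

definition S_e2 :: "real \<Rightarrow> real \<Rightarrow> real \<Rightarrow> real \<Rightarrow> real" where
  "S_e2 a g\<^sub>u b x = b * x + a + g\<^sub>u"

definition S_e3 :: "real \<Rightarrow> real \<Rightarrow> real" where
  "S_e3 c x = c * x"

definition S_e4 :: "real \<Rightarrow> real \<Rightarrow> real \<Rightarrow> real \<Rightarrow> real" where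
  "S_e4 b c g\<^sub>v x = b * x + c + g\<^sub>v"

text \<open>As above, the pair \<open>(F\<^sub>u, F\<^sub>v)\<close> with these properties is unique.\<close>
definition IFS2_attractors ::
    "real \<Rightarrow> real \<Rightarrow> real \<Rightarrow> real \<Rightarrow> real \<Rightarrow> real set \<Rightarrow> real set \<Rightarrow> bool" where
  "IFS2_attractors a g\<^sub>u b c g\<^sub>v F\<^sub>u F\<^sub>v \<longleftrightarrow>
     F\<^sub>u \<noteq> {} \<and> compact F\<^sub>u \<and> F\<^sub>v \<noteq> {} \<and> compact F\<^sub>v \<and>
     F\<^sub>u = S_e1 a ` F\<^sub>u \<union> S_e2 a g\<^sub>u b ` F\<^sub>v \<and>
     F\<^sub>v = S_e3 c ` F\<^sub>v \<union> S_e4 b c g\<^sub>v ` F\<^sub>u"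

text \<open>
  Stated for the list of displayed elements, not for the underlying set, so that independence
  forces the entries to be distinct.
\<close>
definition mult_rat_independent :: "real list \<Rightarrow> bool" where
  "mult_rat_independent us \<longleftrightarrow>
     (\<forall>x\<in>set us. 0 < x) \<and>
     (\<forall>m :: nat \<Rightarrow> int. (\<Prod>i<length us. (us ! i) powi (m i)) = 1 \<longrightarrow> (\<forall>i<length us. m i = 0))"

end

theory Submission
  imports Defs
begin

text \<open>
  Suppose that \<open>F\<^sub>u = \<Union>\<^sub>i S\<^sub>i(F\<^sub>u)\<close> for contracting similarities \<open>S\<^sub>i\<close>. The proof shows that the
  left end point \<open>1 - b = a + g\<^sub>u\<close> of the right-hand piece of \<open>F\<^sub>u\<close> lies in no \<open>S\<^sub>i(F\<^sub>u)\<close>.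

  The first step makes the overlaps of the \<open>S\<^sub>i(F\<^sub>u)\<close> irrelevant: for a similarity \<open>S\<close> of
  ratio \<open>r\<close> with \<open>S(F\<^sub>u) \<subseteq> F\<^sub>u\<close>, the set \<open>S(F\<^sub>u)\<close> is all of \<open>F\<^sub>u \<inter> J\<close>, where \<open>J\<close> is the interval
  \<open>S([0,1])\<close> of length \<open>r\<close> (lemma \<open>similar_copy_is_interval_part\<close>). For this one needs the
  density bound \<open>\<H>\<^sup>s(F\<^sub>u \<inter> J) \<le> |J|\<^sup>s \<H>\<^sup>s(F\<^sub>u)\<close> for all intervals \<open>J\<close> (lemma
  \<open>interval_density\<close>): since \<open>S(F\<^sub>u)\<close> already has measure \<open>r\<^sup>s \<H>\<^sup>s(F\<^sub>u)\<close>, nothing of positive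
  measure is left in \<open>F\<^sub>u \<inter> J\<close>, and every non-empty relatively open part of \<open>F\<^sub>u\<close> has
  positive measure.
  With \<open>a + g\<^sub>u = 1 - b\<close>, the hypothesis \<open>(a + g\<^sub>u) (1 - a\<^sup>s) / (b a\<^sup>s) \<ge> 1\<close> says precisely
  that \<open>b \<le> 1 - a\<^sup>s\<close>: the right-hand piece of \<open>F\<^sub>u\<close> carries at least its share \<open>b\<close> of the
  mass. The density bound is then a consequence of the concavity of \<open>z \<mapsto> z\<^sup>s\<close>, applied along
  the recursive structure of the attractors; \<open>\<H>\<^sup>s(F\<^sub>v) \<le> \<H>\<^sup>s(F\<^sub>u)\<close> ensures that it survives the passage from \<open>F\<^sub>u\<close> to \<open>F\<^sub>v\<close>.

  The second step compares gaps. The gaps of \<open>F\<^sub>u\<close> have lengths \<open>g\<^sub>u w\<close>, with \<open>w\<close> the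
  contraction ratio of a closed walk at \<open>u\<close>, and \<open>g\<^sub>v w\<close>, with \<open>w\<close> that of a walk from \<open>u\<close> to
  \<open>v\<close> (lemma \<open>gap_length\<close>). As \<open>S(F\<^sub>u) = F\<^sub>u \<inter> J\<close>, the gaps of \<open>F\<^sub>u\<close> inside \<open>J\<close> are those of
  \<open>F\<^sub>u\<close> scaled by \<open>r\<close>. By multiplicative independence \<open>r\<close> is therefore itself the ratio of a
  closed walk at \<open>u\<close>. If \<open>J\<close> contained \<open>1 - b\<close>, then it could not contain the central gap
  of \<open>F\<^sub>u\<close>, so \<open>1 - b\<close> would be its left end point; but then \<open>J\<close> would contain a gap
  of length \<open>b c\<^sup>m g\<^sub>v\<close>, which is \<open>r\<close> times a gap length of \<open>F\<^sub>u\<close> only if \<open>r = 1\<close> (lemma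
  \<open>similar_interval_part_avoids_right_piece\<close>).

  The hypothesis on the dimension enters through \<open>0 < \<H>\<^sup>s < \<infinity>\<close> for both attractors (lemma
  \<open>measure_positive_finite_at_dim\<close>), which is proved by estimating sums over finite covers.
\<close>

section \<open>Hausdorff measure\<close>

lemma diam_pow_mono:
  assumes "U \<subseteq> V" "bounded V" "0 \<le> s"
  shows "diam_pow s U \<le> diam_pow s V"
proof -
  have "0 \<le> diameter U" "diameter U \<le> diameter V"
    using assms diameter_ge_0 diameter_subset bounded_subset by metis+
  then show ?thesis
    using assms by (auto simp: diam_pow_def intro!: ennreal_leI powr_mono2)
qed

lemma hausdorff_premeasure_le:
  assumes "U \<in> delta_covers \<delta> E"
  shows "hausdorff_premeasure s \<delta> E \<le> (\<Sum>i. diam_pow s (U i))"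
  unfolding hausdorff_premeasure_def using assms by (rule INF_lower)

lemma hausdorff_premeasure_mono:
  assumes "A \<subseteq> B"
  shows "hausdorff_premeasure s \<delta> A \<le> hausdorff_premeasure s \<delta> B"
  unfolding hausdorff_premeasure_def
  by (rule INF_superset_mono) (use assms in \<open>auto simp: delta_covers_def\<close>)

lemma hausdorff_premeasure_antimono:
  assumes "\<delta> \<le> \<delta>'"
  shows "hausdorff_premeasure s \<delta>' E \<le> hausdorff_premeasure s \<delta> E"
  unfolding hausdorff_premeasure_def
  by (rule INF_superset_mono) (use assms in \<open>auto simp: delta_covers_def intro: order_trans\<close>)

lemma hausdorff_premeasure_le_measure:
  "0 < \<delta> \<Longrightarrow> hausdorff_premeasure s \<delta> E \<le> hausdorff_measure s E"
  unfolding hausdorff_measure_def by (intro SUP_upper) simp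

lemma hausdorff_measure_mono:
  assumes "A \<subseteq> B"
  shows "hausdorff_measure s A \<le> hausdorff_measure s B"
  unfolding hausdorff_measure_def
  by (rule SUP_mono', rule hausdorff_premeasure_mono[OF assms])

lemma hausdorff_measure_empty: "hausdorff_measure s {} = 0"
proof -
  have "hausdorff_premeasure s \<delta> ({} :: 'a set) \<le> 0" if "0 < \<delta>" for \<delta>
    using hausdorff_premeasure_le[of "\<lambda>_. {}" \<delta> "{} :: 'a set" s] that
    by (simp add: delta_covers_def diam_pow_def)
  then have "hausdorff_measure s ({} :: 'a set) \<le> 0"
    unfolding hausdorff_measure_def by (intro SUP_least) auto
  then show ?thesis by simp
qed

text \<open>
  Interleaving a cover of \<open>A\<close> with one of \<open>B\<close> gives a cover of the union.
\<close>
lemma hausdorff_premeasure_Un: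
  "hausdorff_premeasure s \<delta> (A \<union> B)
     \<le> hausdorff_premeasure s \<delta> A + hausdorff_premeasure s \<delta> B"
proof -
  have *: "hausdorff_premeasure s \<delta> (A \<union> B) \<le> (\<Sum>i. diam_pow s (U i)) + (\<Sum>i. diam_pow s (V i))"
    if U: "U \<in> delta_covers \<delta> A" and V: "V \<in> delta_covers \<delta> B" for U V
  proof -
    define W where "W i = (if even i then U (i div 2) else V (i div 2))" for i :: nat
    have W: "W (i * 2) = U i" "W (Suc (i * 2)) = V i" for i
      by (auto simp: W_def)
    have "A \<union> B \<subseteq> (\<Union>i. W i)"
    proof
      fix x assume "x \<in> A \<union> B"
      with U V have "\<exists>i. x \<in> U i \<or> x \<in> V i"
        by (auto simp: delta_covers_def)
      then show "x \<in> (\<Union>i. W i)"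
        using W by (metis UNIV_I UN_I)
    qed
    moreover have "\<forall>i. bounded (W i) \<and> diameter (W i) \<le> \<delta>"
      using U V by (simp add: delta_covers_def W_def)
    ultimately have "W \<in> delta_covers \<delta> (A \<union> B)"
      unfolding delta_covers_def by blast
    then have "hausdorff_premeasure s \<delta> (A \<union> B) \<le> (\<Sum>i. diam_pow s (W i))"
      by (rule hausdorff_premeasure_le)
    also have "\<dots> \<le> (\<Sum>i. diam_pow s (U i)) + (\<Sum>i. diam_pow s (V i))"
    proof (rule suminf_le_const)
      fix n
      have "(\<Sum>i<n. diam_pow s (W i)) \<le> (\<Sum>i<2*n. diam_pow s (W i))"
        by (rule sum_mono2) auto
      also have "\<dots> = (\<Sum>i<n. diam_pow s (U i)) + (\<Sum>i<n. diam_pow s (V i))"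
        by (induction n) (simp_all add: W ac_simps)
      also have "\<dots> \<le> (\<Sum>i. diam_pow s (U i)) + (\<Sum>i. diam_pow s (V i))"
        by (intro add_mono sum_le_suminf) auto
      finally show "(\<Sum>i<n. diam_pow s (W i)) \<le> \<dots>" .
    qed auto
    finally show ?thesis .
  qed
  show ?thesis
  proof (cases "hausdorff_premeasure s \<delta> A = \<infinity> \<or> hausdorff_premeasure s \<delta> B = \<infinity>")
    case False
    show ?thesis
    proof (rule ennreal_le_epsilon)
      fix e :: real assume "0 < e"
      then have e: "0 < e / 2" by simp
      obtain U where U: "U \<in> delta_covers \<delta> A"
          "(\<Sum>i. diam_pow s (U i)) < hausdorff_premeasure s \<delta> A + ennreal (e / 2)"
        using INF_approx_ennreal[OF e hausdorff_premeasure_def] False by blast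
      obtain V where V: "V \<in> delta_covers \<delta> B"
          "(\<Sum>i. diam_pow s (V i)) < hausdorff_premeasure s \<delta> B + ennreal (e / 2)"
        using INF_approx_ennreal[OF e hausdorff_premeasure_def] False by blast
      have "ennreal e = ennreal (e / 2) + ennreal (e / 2)"
        using \<open>0 < e\<close> by (simp flip: ennreal_plus)
      then show "hausdorff_premeasure s \<delta> (A \<union> B)
          \<le> hausdorff_premeasure s \<delta> A + hausdorff_premeasure s \<delta> B + ennreal e"
        using order_trans[OF *[OF U(1) V(1)] add_mono[OF less_imp_le[OF U(2)] less_imp_le[OF V(2)]]]
        by (simp add: ac_simps)
    qed
  qed auto
qed

lemma hausdorff_measure_Un:
  "hausdorff_measure s (A \<union> B) \<le> hausdorff_measure s A + hausdorff_measure s B"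
  unfolding hausdorff_measure_def[of s "A \<union> B"]
proof (rule SUP_least)
  fix \<delta> :: real assume "\<delta> \<in> {0<..}"
  then show "hausdorff_premeasure s \<delta> (A \<union> B) \<le> hausdorff_measure s A + hausdorff_measure s B"
    using hausdorff_premeasure_Un[of s \<delta> A B] hausdorff_premeasure_le_measure
    by (metis add_mono greaterThan_iff order_trans)
qed

text \<open>
  Once \<open>\<delta>\<close> is below the distance of the two sets, no set of a \<open>\<delta>\<close>-cover meets both of
  them, so that the cover splits into a cover of each.
\<close>
lemma hausdorff_measure_Un_separated:
  assumes "0 < g" and sep: "\<And>x y. x \<in> A \<Longrightarrow> y \<in> B \<Longrightarrow> g \<le> dist x y" and "0 \<le> s"
  shows "hausdorff_measure s (A \<union> B) = hausdorff_measure s A + hausdorff_measure s B"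
proof (rule antisym[OF hausdorff_measure_Un])
  have *: "hausdorff_premeasure s \<delta> A + hausdorff_premeasure s \<delta> B
             \<le> hausdorff_premeasure s \<delta> (A \<union> B)" if "0 < \<delta>" "\<delta> < g" for \<delta>
    unfolding hausdorff_premeasure_def[of s \<delta> "A \<union> B"]
  proof (rule INF_greatest)
    fix U assume U: "U \<in> delta_covers \<delta> (A \<union> B)"
    then have bd: "bounded (U i)" and di: "diameter (U i) \<le> \<delta>" for i
      by (auto simp: delta_covers_def)
    have "(\<lambda>i. U i \<inter> A) \<in> delta_covers \<delta> A" "(\<lambda>i. U i \<inter> B) \<in> delta_covers \<delta> B"
      using U diameter_subset[OF Int_lower1 bd] order_trans[OF _ di]
      by (auto simp: delta_covers_def intro!: bounded_Int)
    then have "hausdorff_premeasure s \<delta> A + hausdorff_premeasure s \<delta> B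
        \<le> (\<Sum>i. diam_pow s (U i \<inter> A)) + (\<Sum>i. diam_pow s (U i \<inter> B))"
      by (intro add_mono hausdorff_premeasure_le)
    also have "\<dots> = (\<Sum>i. diam_pow s (U i \<inter> A) + diam_pow s (U i \<inter> B))"
      by (rule suminf_add) auto
    also have "\<dots> \<le> (\<Sum>i. diam_pow s (U i))"
    proof (rule suminf_le)
      fix i
      have "U i \<inter> A = {} \<or> U i \<inter> B = {}"
      proof (rule ccontr)
        assume "\<not> ?thesis"
        then obtain x y where "x \<in> U i" "x \<in> A" "y \<in> U i" "y \<in> B"
          by blast
        then show False
          using diameter_bounded_bound[OF bd, of x i y] di[of i] sep[of x y] \<open>\<delta> < g\<close> by simp
      qed
      then show "diam_pow s (U i \<inter> A) + diam_pow s (U i \<inter> B) \<le> diam_pow s (U i)"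
        using diam_pow_mono[OF Int_lower1 bd \<open>0 \<le> s\<close>] by (auto simp: diam_pow_def[of s "{}"])
    qed auto
    finally show "hausdorff_premeasure s \<delta> A + hausdorff_premeasure s \<delta> B
        \<le> (\<Sum>i. diam_pow s (U i))" .
  qed
  have "hausdorff_measure s A + hausdorff_measure s B
      = (SUP \<delta>\<in>{0<..}. hausdorff_premeasure s \<delta> A + hausdorff_premeasure s \<delta> B)"
    unfolding hausdorff_measure_def
  proof (rule SUP_add_directed_ennreal[symmetric])
    fix i j :: real assume "i \<in> {0<..}" "j \<in> {0<..}"
    then show "\<exists>k\<in>{0<..}. hausdorff_premeasure s i A + hausdorff_premeasure s j B
        \<le> hausdorff_premeasure s k A + hausdorff_premeasure s k B"
      by (intro bexI[of _ "min i j"] add_mono hausdorff_premeasure_antimono) auto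
  qed
  also have "\<dots> \<le> hausdorff_measure s (A \<union> B)"
  proof (rule SUP_least)
    fix \<delta> :: real assume "\<delta> \<in> {0<..}"
    define \<eta> where "\<eta> = min \<delta> (g / 2)"
    have \<eta>: "0 < \<eta>" "\<eta> < g" "\<eta> \<le> \<delta>"
      using \<open>\<delta> \<in> {0<..}\<close> \<open>0 < g\<close> by (auto simp: \<eta>_def)
    have "hausdorff_premeasure s \<delta> A + hausdorff_premeasure s \<delta> B
        \<le> hausdorff_premeasure s \<eta> A + hausdorff_premeasure s \<eta> B"
      using \<eta> by (intro add_mono hausdorff_premeasure_antimono)
    also have "\<dots> \<le> hausdorff_measure s (A \<union> B)"
      using *[OF \<eta>(1,2)] hausdorff_premeasure_le_measure[OF \<eta>(1)] order_trans by blast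
    finally show "hausdorff_premeasure s \<delta> A + hausdorff_premeasure s \<delta> B
        \<le> hausdorff_measure s (A \<union> B)" .
  qed
  finally show "hausdorff_measure s A + hausdorff_measure s B \<le> hausdorff_measure s (A \<union> B)" .
qed

lemma diameter_leI:
  fixes S :: "'a::metric_space set"
  assumes "0 \<le> d" "\<And>x y. x \<in> S \<Longrightarrow> y \<in> S \<Longrightarrow> dist x y \<le> d"
  shows "diameter S \<le> d"
  using assms by (auto simp: diameter_def intro!: cSUP_least)

lemma similarity_diameter:
  assumes f: "\<And>x y. dist (f x) (f y) = r * dist x y" and r: "0 < r"
  shows "bounded U \<Longrightarrow> bounded (f ` U)"
    and "bounded U \<Longrightarrow> diameter (f ` U) \<le> r * diameter U"
    and "bounded V \<Longrightarrow> bounded (f -` V)"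
    and "bounded V \<Longrightarrow> diameter (f -` V) \<le> diameter V / r"
proof -
  have 1: "dist x y \<le> r * diameter U" if "bounded U" "x \<in> f ` U" "y \<in> f ` U" for x y
    using that f r diameter_bounded_bound[OF \<open>bounded U\<close>] by (auto intro!: mult_left_mono)
  have 2: "dist x y \<le> diameter V / r" if "bounded V" "x \<in> f -` V" "y \<in> f -` V" for x y
    using diameter_bounded_bound[OF \<open>bounded V\<close>, of "f x" "f y"] that f r
    by (auto simp: field_simps)
  show "bounded U \<Longrightarrow> bounded (f ` U)" "bounded V \<Longrightarrow> bounded (f -` V)"
    unfolding bounded_two_points[of "f ` U"] bounded_two_points[of "f -` V"] using 1 2 by blast+
  show "diameter (f ` U) \<le> r * diameter U" if "bounded U"
    using 1[OF that] diameter_ge_0[OF that] r by (intro diameter_leI) auto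
  show "diameter (f -` V) \<le> diameter V / r" if "bounded V"
    using 2[OF that] diameter_ge_0[OF that] r by (intro diameter_leI) auto
qed

lemma diam_pow_scale:
  assumes "diameter U \<le> r * diameter V" "V = {} \<Longrightarrow> U = {}" "bounded U" "bounded V" "0 < r" "0 < s"
  shows "diam_pow s U \<le> ennreal (r powr s) * diam_pow s V"
proof (cases "U = {}")
  case False
  have "diameter U powr s \<le> (r * diameter V) powr s"
    using assms by (intro powr_mono2 diameter_ge_0) auto
  also have "\<dots> = r powr s * diameter V powr s"
    using assms diameter_ge_0[of V] by (simp add: powr_mult)
  finally show ?thesis
    using False assms by (auto simp: diam_pow_def intro!: ennreal_leI simp flip: ennreal_mult)
qed (simp add: diam_pow_def)

lemma ennreal_mult_le_iff_le_mult:
  assumes "0 < c"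
  shows "ennreal c * x \<le> y \<longleftrightarrow> x \<le> ennreal (1 / c) * y"
proof -
  have *: "ennreal c * ennreal (1 / c) = 1" "ennreal (1 / c) * ennreal c = 1"
    using assms by (simp_all flip: ennreal_mult)
  show ?thesis
    using mult_left_mono[of "ennreal c * x" y "ennreal (1 / c)"]
      mult_left_mono[of x "ennreal (1 / c) * y" "ennreal c"] *
    by (auto simp flip: mult.assoc)
qed

text \<open>
  Covers of \<open>E\<close> are pushed forward along \<open>f\<close> for the upper bound, and covers of \<open>f ` E\<close> are
  pulled back for the lower one.
\<close>
lemma
  assumes f: "\<And>x y. dist (f x) (f y) = r * dist x y" and r: "0 < r" and s: "0 < s"
  shows hausdorff_premeasure_similarity_le:
      "hausdorff_premeasure s (r * \<delta>) (f ` E) \<le> ennreal (r powr s) * hausdorff_premeasure s \<delta> E"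
    and hausdorff_measure_similarity:
      "hausdorff_measure s (f ` E) = ennreal (r powr s) * hausdorff_measure s E"
proof -
  have le: "hausdorff_premeasure s (r * \<delta>) (f ` E) \<le> ennreal (r powr s) * hausdorff_premeasure s \<delta> E" for \<delta>
  proof -
    have "ennreal (1 / r powr s) * hausdorff_premeasure s (r * \<delta>) (f ` E) \<le> hausdorff_premeasure s \<delta> E"
      unfolding hausdorff_premeasure_def[of s \<delta> E]
    proof (rule INF_greatest)
      fix U assume U: "U \<in> delta_covers \<delta> E"
      then have bd: "bounded (U i)" and di: "diameter (U i) \<le> \<delta>" for i
        by (auto simp: delta_covers_def)
      have "r * diameter (U i) \<le> r * \<delta>" for i
        using di r by simp
      then have "diameter (f ` U i) \<le> r * \<delta>" for i
        using similarity_diameter(2)[OF f r bd] order_trans by blast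
      moreover have "E \<subseteq> (\<Union>i. U i)"
        using U by (simp add: delta_covers_def)
      then have "f ` E \<subseteq> (\<Union>i. f ` U i)"
        by blast
      ultimately have "(\<lambda>i. f ` U i) \<in> delta_covers (r * \<delta>) (f ` E)"
        using similarity_diameter(1)[OF f r bd] by (simp add: delta_covers_def)
      then have "hausdorff_premeasure s (r * \<delta>) (f ` E) \<le> (\<Sum>i. diam_pow s (f ` U i))"
        by (rule hausdorff_premeasure_le)
      also have "\<dots> \<le> (\<Sum>i. ennreal (r powr s) * diam_pow s (U i))"
        using bd similarity_diameter[OF f r] r s by (intro suminf_le diam_pow_scale) auto
      finally show "ennreal (1 / r powr s) * hausdorff_premeasure s (r * \<delta>) (f ` E)
          \<le> (\<Sum>i. diam_pow s (U i))"
        using r by (subst ennreal_mult_le_iff_le_mult) auto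
    qed
    then show ?thesis
      using r by (subst (asm) ennreal_mult_le_iff_le_mult) auto
  qed
  then show "hausdorff_premeasure s (r * \<delta>) (f ` E) \<le> ennreal (r powr s) * hausdorff_premeasure s \<delta> E" .
  have ge: "ennreal (r powr s) * hausdorff_premeasure s \<delta> E \<le> hausdorff_premeasure s (r * \<delta>) (f ` E)" for \<delta>
    unfolding hausdorff_premeasure_def[of s "r * \<delta>"]
  proof (rule INF_greatest)
    fix V assume V: "V \<in> delta_covers (r * \<delta>) (f ` E)"
    then have bd: "bounded (V i)" and di: "diameter (V i) \<le> r * \<delta>" for i
      by (auto simp: delta_covers_def)
    have "diameter (V i) / r \<le> \<delta>" for i
      using di r by (simp add: field_simps)
    then have "diameter (f -` V i) \<le> \<delta>" for i
      using similarity_diameter(4)[OF f r bd] order_trans by blast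
    moreover have "f ` E \<subseteq> (\<Union>i. V i)"
      using V by (simp add: delta_covers_def)
    then have "E \<subseteq> (\<Union>i. f -` V i)"
      by blast
    ultimately have "(\<lambda>i. f -` V i) \<in> delta_covers \<delta> E"
      using similarity_diameter(3)[OF f r bd] by (simp add: delta_covers_def)
    then have "hausdorff_premeasure s \<delta> E \<le> (\<Sum>i. diam_pow s (f -` V i))"
      by (rule hausdorff_premeasure_le)
    also have "\<dots> \<le> (\<Sum>i. ennreal ((1 / r) powr s) * diam_pow s (V i))"
      using bd similarity_diameter[OF f r] r s by (intro suminf_le diam_pow_scale) auto
    finally show "ennreal (r powr s) * hausdorff_premeasure s \<delta> E \<le> (\<Sum>i. diam_pow s (V i))"
      using r by (subst ennreal_mult_le_iff_le_mult) (auto simp: powr_divide)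
  qed
  show "hausdorff_measure s (f ` E) = ennreal (r powr s) * hausdorff_measure s E"
  proof (rule antisym)
    show "hausdorff_measure s (f ` E) \<le> ennreal (r powr s) * hausdorff_measure s E"
      unfolding hausdorff_measure_def[of s "f ` E"]
    proof (rule SUP_least)
      fix \<delta> :: real assume "\<delta> \<in> {0<..}"
      then have "hausdorff_premeasure s (\<delta> / r) E \<le> hausdorff_measure s E"
        using r by (intro hausdorff_premeasure_le_measure) auto
      then show "hausdorff_premeasure s \<delta> (f ` E) \<le> ennreal (r powr s) * hausdorff_measure s E"
        using le[of "\<delta> / r"] r mult_left_mono order_trans by fastforce
    qed
    show "ennreal (r powr s) * hausdorff_measure s E \<le> hausdorff_measure s (f ` E)"
      unfolding hausdorff_measure_def[of s E] SUP_mult_left_ennreal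
    proof (rule SUP_least)
      fix \<delta> :: real assume "\<delta> \<in> {0<..}"
      then show "ennreal (r powr s) * hausdorff_premeasure s \<delta> E \<le> hausdorff_measure s (f ` E)"
        using ge[of \<delta>] hausdorff_premeasure_le_measure[of "r * \<delta>" s "f ` E"] r
        by (auto intro: order_trans)
    qed
  qed
qed

text \<open>
  The sets of a countable cover may be enlarged to open ones at an arbitrarily small
  expense, after which compactness leaves a finite subcover.
\<close>
lemma hausdorff_measure_ge_finite_covers:
  fixes E :: "'a::metric_space set"
  assumes "compact E" "0 < s"
    and fin: "\<And>I U. finite I \<Longrightarrow> E \<subseteq> (\<Union>i\<in>I. U i) \<Longrightarrow> (\<And>i. i \<in> I \<Longrightarrow> bounded (U i))
      \<Longrightarrow> k \<le> (\<Sum>i\<in>(I::nat set). diameter (U i) powr s)"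
  shows "ennreal k \<le> hausdorff_measure s E"
proof -
  have "ennreal k \<le> hausdorff_premeasure s 1 E"
    unfolding hausdorff_premeasure_def
  proof (rule INF_greatest)
    fix U assume U: "U \<in> delta_covers 1 E"
    then have bd: "bounded (U i)" and sub: "E \<subseteq> (\<Union>i. U i)" for i
      by (auto simp: delta_covers_def)
    show "ennreal k \<le> (\<Sum>i. diam_pow s (U i))"
    proof (rule ennreal_le_epsilon)
      fix e :: real assume e: "0 < e"
      have "\<exists>h>0. (diameter (U i) + 2 * h) powr s \<le> diameter (U i) powr s + e * (1/2) ^ Suc i" for i
      proof -
        define f where "f h = (diameter (U i) + 2 * h) powr s" for h
        have "(f \<longlongrightarrow> f 0) (at_right 0)"
          unfolding f_def using \<open>0 < s\<close> diameter_ge_0[OF bd, of i]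
          by (intro tendsto_powr2 tendsto_intros)
             (auto simp: eventually_at_right_field intro!: exI[of _ 1])
        then have "eventually (\<lambda>h. f h < f 0 + e * (1/2) ^ Suc i) (at_right 0)"
          using e by (intro order_tendstoD) auto
        moreover have "eventually (\<lambda>h::real. 0 < h) (at_right 0)"
          by (simp add: eventually_at_right_less)
        ultimately have "eventually (\<lambda>h. 0 < h \<and> f h < f 0 + e * (1/2) ^ Suc i) (at_right 0)"
          by eventually_elim auto
        then obtain h where "0 < h" "f h < f 0 + e * (1/2) ^ Suc i"
          by (metis (no_types, lifting) eventually_happens trivial_limit_at_right_real)
        then show ?thesis by (auto simp: f_def intro!: exI[of _ h])
      qed
      then obtain h where h: "h i > 0"
          "(diameter (U i) + 2 * h i) powr s \<le> diameter (U i) powr s + e * (1/2) ^ Suc i" for i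
        by metis
      define V where "V i = (\<Union>x\<in>U i. ball x (h i))" for i
      have V_dist: "dist x y \<le> diameter (U i) + 2 * h i" if "x \<in> V i" "y \<in> V i" for x y i
      proof -
        from that obtain x' y' where *: "x' \<in> U i" "y' \<in> U i" "dist x' x < h i" "dist y' y < h i"
          by (auto simp: V_def)
        have "dist x' y' \<le> diameter (U i)"
          using * diameter_bounded_bound[OF bd] by blast
        moreover have "dist x y \<le> dist x' x + dist x' y' + dist y' y"
          using dist_triangle[of x y x'] dist_triangle[of x' y y'] by (simp add: dist_commute)
        ultimately show ?thesis using * by linarith
      qed
      have V_bd: "bounded (V i)" for i
        unfolding bounded_two_points using V_dist by blast
      have "E \<subseteq> (\<Union>i\<in>UNIV. V i)"
      proof
        fix x assume "x \<in> E"
        then obtain i where "x \<in> U i" using sub by blast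
        then have "x \<in> V i" using h(1)[of i] by (auto simp: V_def intro!: bexI[of _ x])
        then show "x \<in> (\<Union>i\<in>UNIV. V i)" by blast
      qed
      moreover have "open (V i)" for i by (simp add: V_def open_UN)
      ultimately obtain I where I: "finite I" "E \<subseteq> (\<Union>i\<in>I. V i)"
        using compactE_image[OF \<open>compact E\<close>, of UNIV V] by metis
      have V_pow: "ennreal (diameter (V i) powr s) \<le> diam_pow s (U i) + ennreal (e * (1/2) ^ Suc i)" for i
      proof (cases "U i = {}")
        case False
        have "diameter (V i) \<le> diameter (U i) + 2 * h i"
          using V_dist h(1)[of i] diameter_ge_0[OF bd, of i] by (intro diameter_leI) auto
        then have "diameter (V i) powr s \<le> (diameter (U i) + 2 * h i) powr s"
          using \<open>0 < s\<close> diameter_ge_0[OF V_bd] by (intro powr_mono2) auto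
        also note h(2)
        finally show ?thesis
          using False e \<open>0 < s\<close> by (simp add: diam_pow_def ennreal_leI flip: ennreal_plus)
      qed (simp add: V_def)
      have "k \<le> (\<Sum>i\<in>I. diameter (V i) powr s)"
        using I V_bd by (intro fin)
      then have "ennreal k \<le> (\<Sum>i\<in>I. ennreal (diameter (V i) powr s))"
        by (subst sum_ennreal) (auto intro: ennreal_leI)
      also have "\<dots> \<le> (\<Sum>i\<in>I. diam_pow s (U i)) + (\<Sum>i\<in>I. ennreal (e * (1/2) ^ Suc i))"
        unfolding sum.distrib[symmetric] by (intro sum_mono V_pow)
      also have "\<dots> \<le> (\<Sum>i. diam_pow s (U i)) + (\<Sum>i. ennreal (e * (1/2) ^ Suc i))"
        using I(1) by (intro add_mono sum_le_suminf) auto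
      also have "(\<Sum>i. ennreal (e * (1/2) ^ Suc i)) = ennreal e"
        using sums_mult[OF power_half_series, of e] e
        by (intro suminf_ennreal_eq) auto
      finally show "ennreal k \<le> (\<Sum>i. diam_pow s (U i)) + ennreal e" .
    qed
  qed
  also have "\<dots> \<le> hausdorff_measure s E"
    by (rule hausdorff_premeasure_le_measure) simp
  finally show ?thesis .
qed

lemma hausdorff_measure_antimono_exponent:
  fixes E :: "'a::metric_space set"
  assumes "0 \<le> t" "t \<le> s"
  shows "hausdorff_measure s E \<le> hausdorff_measure t E"
proof -
  have pow: "diam_pow s U \<le> diam_pow t U" if "bounded U" "diameter U \<le> 1" for U :: "'a set"
  proof -
    have "diameter U powr s \<le> 1"
      using that assms diameter_ge_0[of U] powr_le1 by auto
    moreover have "diameter U powr s \<le> diameter U powr t"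
      using that assms diameter_ge_0[of U] by (cases "diameter U = 0") (auto intro!: powr_mono')
    ultimately show ?thesis
      using assms by (auto simp: diam_pow_def ennreal_leI)
  qed
  have "hausdorff_premeasure s \<delta> E \<le> hausdorff_premeasure t (min 1 \<delta>) E" for \<delta>
    unfolding hausdorff_premeasure_def
  proof (rule INF_greatest)
    fix U assume "U \<in> delta_covers (min 1 \<delta>) E"
    then have "U \<in> delta_covers \<delta> E" "\<And>i. bounded (U i)" "\<And>i. diameter (U i) \<le> 1"
      by (auto simp: delta_covers_def)
    then show "(INF U\<in>delta_covers \<delta> E. \<Sum>i. diam_pow s (U i)) \<le> (\<Sum>i. diam_pow t (U i))"
      by (intro INF_lower2[of U] suminf_le pow) auto
  qed
  moreover have "hausdorff_premeasure t (min 1 \<delta>) E \<le> hausdorff_measure t E" if "0 < \<delta>" for \<delta>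
    using that by (intro hausdorff_premeasure_le_measure) auto
  ultimately show ?thesis
    unfolding hausdorff_measure_def[of s] by (intro SUP_least) (use order_trans in blast)
qed

text \<open>
  Sets of diameter at most \<open>\<delta>\<close> satisfy \<open>|U|\<^sup>t \<le> \<delta>\<^sup>t\<^sup>-\<^sup>s |U|\<^sup>s\<close>, and the factor tends to \<open>0\<close>
  with \<open>\<delta>\<close>.
\<close>
lemma hausdorff_measure_eq_0_above:
  fixes E :: "'a::metric_space set"
  assumes "hausdorff_measure s E < \<infinity>" "0 \<le> s" "s < t"
  shows "hausdorff_measure t E = 0"
proof -
  obtain h where h: "hausdorff_measure s E = ennreal h" "0 \<le> h"
    using assms(1) by (cases "hausdorff_measure s E") auto
  have pow: "diam_pow t U \<le> ennreal (\<delta> powr (t - s)) * diam_pow s U"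
    if "bounded U" "diameter U \<le> \<delta>" "0 < \<delta>" for U :: "'a set" and \<delta>
  proof (cases "U = {}")
    case False
    have d: "0 \<le> diameter U" using that diameter_ge_0 by auto
    have "diameter U powr t = diameter U powr (t - s) * diameter U powr s"
      by (simp flip: powr_add)
    also have "\<dots> \<le> \<delta> powr (t - s) * diameter U powr s"
      using d that assms by (intro mult_right_mono powr_mono2) auto
    finally have "diameter U powr t \<le> \<delta> powr (t - s) * diameter U powr s" .
    moreover have "diameter U powr t \<le> \<delta> powr t"
      using d that assms by (intro powr_mono2) auto
    ultimately show ?thesis
      using False assms by (auto simp: diam_pow_def ennreal_leI simp flip: ennreal_mult)
  qed (simp add: diam_pow_def)
  have pre: "hausdorff_premeasure t \<delta> E \<le> ennreal (\<delta> powr (t - s) * h)" if "0 < \<delta>" for \<delta>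
  proof -
    have "ennreal (1 / \<delta> powr (t - s)) * hausdorff_premeasure t \<delta> E \<le> hausdorff_premeasure s \<delta> E"
      unfolding hausdorff_premeasure_def[of s \<delta> E]
    proof (rule INF_greatest)
      fix U assume U: "U \<in> delta_covers \<delta> E"
      then have "hausdorff_premeasure t \<delta> E \<le> (\<Sum>i. diam_pow t (U i))"
        by (rule hausdorff_premeasure_le)
      also have "\<dots> \<le> (\<Sum>i. ennreal (\<delta> powr (t - s)) * diam_pow s (U i))"
        using U that by (intro suminf_le pow) (auto simp: delta_covers_def)
      finally show "ennreal (1 / \<delta> powr (t - s)) * hausdorff_premeasure t \<delta> E \<le> (\<Sum>i. diam_pow s (U i))"
        using that by (subst ennreal_mult_le_iff_le_mult) auto
    qed
    also have "\<dots> \<le> ennreal h"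
      using hausdorff_premeasure_le_measure[OF that] h(1) by metis
    finally show ?thesis
      using that h(2) by (subst (asm) ennreal_mult_le_iff_le_mult) (auto simp: ennreal_mult)
  qed
  have "hausdorff_premeasure t \<delta> E \<le> 0" if "0 < \<delta>" for \<delta>
  proof (rule ennreal_le_epsilon)
    fix e :: real assume "0 < e"
    have "((\<lambda>\<eta>. \<eta> powr (t - s) * h) \<longlongrightarrow> 0 powr (t - s) * h) (at_right 0)"
      using \<open>s < t\<close>
      by (intro tendsto_powr2 tendsto_intros) (auto simp: eventually_at_right_field intro!: exI[of _ 1])
    then have "eventually (\<lambda>\<eta>. \<eta> powr (t - s) * h < e) (at_right 0)"
      using \<open>0 < e\<close> by (intro order_tendstoD) auto
    moreover have "eventually (\<lambda>\<eta>. \<eta> \<in> {0<..<\<delta>}) (at_right 0)"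
      using that by (rule eventually_at_right_real)
    ultimately have "eventually (\<lambda>\<eta>. \<eta> \<in> {0<..<\<delta>} \<and> \<eta> powr (t - s) * h < e) (at_right 0)"
      by eventually_elim auto
    then obtain \<eta> where \<eta>: "0 < \<eta>" "\<eta> < \<delta>" "\<eta> powr (t - s) * h < e"
      by (metis (no_types, lifting) eventually_happens greaterThanLessThan_iff trivial_limit_at_right_real)
    have "hausdorff_premeasure t \<delta> E \<le> hausdorff_premeasure t \<eta> E"
      using \<eta> by (intro hausdorff_premeasure_antimono) auto
    also have "\<dots> \<le> ennreal (\<eta> powr (t - s) * h)"
      using \<eta> by (intro pre)
    also have "\<dots> \<le> ennreal e"
      using \<eta> by (intro ennreal_leI) auto
    finally show "hausdorff_premeasure t \<delta> E \<le> 0 + ennreal e" by simp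
  qed
  then have "hausdorff_measure t E \<le> 0"
    unfolding hausdorff_measure_def by (intro SUP_least) auto
  then show ?thesis by simp
qed

lemma hausdorff_dim_eqI:
  fixes E :: "'a::metric_space set"
  assumes "0 < hausdorff_measure s E" "hausdorff_measure s E < \<infinity>" "0 \<le> s"
  shows "hausdorff_dim E = ennreal s"
  unfolding hausdorff_dim_def
proof (rule antisym)
  show "(INF t\<in>{t. 0 \<le> t \<and> hausdorff_measure t E = 0}. ennreal t) \<le> ennreal s"
  proof (rule ennreal_le_epsilon)
    fix e :: real assume "0 < e"
    then have "hausdorff_measure (s + e) E = 0"
      using assms by (intro hausdorff_measure_eq_0_above[of s]) auto
    then have "(INF t\<in>{t. 0 \<le> t \<and> hausdorff_measure t E = 0}. ennreal t) \<le> ennreal (s + e)"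
      using assms \<open>0 < e\<close> by (intro INF_lower) auto
    then show "(INF t\<in>{t. 0 \<le> t \<and> hausdorff_measure t E = 0}. ennreal t) \<le> ennreal s + ennreal e"
      using assms \<open>0 < e\<close> by (simp add: ennreal_plus)
  qed
  show "ennreal s \<le> (INF t\<in>{t. 0 \<le> t \<and> hausdorff_measure t E = 0}. ennreal t)"
  proof (rule INF_greatest, rule ccontr)
    fix t assume t: "t \<in> {t. 0 \<le> t \<and> hausdorff_measure t E = 0}" "\<not> ennreal s \<le> ennreal t"
    then have "t \<le> s"
      using ennreal_leI[of s t] by linarith
    then have "hausdorff_measure s E \<le> hausdorff_measure t E"
      using t by (intro hausdorff_measure_antimono_exponent) auto
    then show False
      using t(1) assms(1) by simp
  qed
qed

section \<open>Bounding a self-similar mass distribution by interval length\<close>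

text \<open>
  The left-hand side decreases in \<open>q\<close>, so it is largest at \<open>q = \<beta>\<close>, where the claim is the
  concavity of \<open>z \<mapsto> z\<^sup>s\<close> (used below as convexity of the inverse power \<open>z \<mapsto> z\<^sup>1\<^sup>/\<^sup>s\<close>).
\<close>
lemma powr_affine_bound:
  fixes x s :: real
  assumes "0 < s" "s \<le> 1" "0 \<le> \<beta>" "\<beta> \<le> q" "q \<le> 1" "0 \<le> x" "x \<le> 1"
  shows "1 - q + q * x powr s \<le> (1 - \<beta> + \<beta> * x) powr s"
proof -
  have xs: "0 \<le> x powr s" "x powr s \<le> 1"
    using assms by (auto intro: powr_le1)
  have "\<beta> * (1 - x powr s) \<le> q * (1 - x powr s)"
    using assms xs by (intro mult_right_mono) auto
  then have "1 - q + q * x powr s \<le> (1 - \<beta>) + \<beta> * x powr s"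
    by (simp add: algebra_simps)
  also have "\<dots> \<le> (1 - \<beta> + \<beta> * x) powr s"
  proof (cases "x = 0")
    case True
    have "(1 - \<beta>) powr 1 \<le> (1 - \<beta>) powr s"
      using assms by (intro powr_mono') auto
    then show ?thesis using True assms by simp
  next
    case False
    then have x: "0 < x" using assms by simp
    have "((1 - \<beta>) *\<^sub>R 1 + \<beta> *\<^sub>R x powr s) powr (1 / s)
        \<le> (1 - \<beta>) * 1 powr (1 / s) + \<beta> * (x powr s) powr (1 / s)"
      using assms x by (intro convex_onD[OF powr_convex]) auto
    then have "((1 - \<beta>) + \<beta> * x powr s) powr (1 / s) \<le> 1 - \<beta> + \<beta> * x"
      using assms x by (simp add: powr_powr)
    then have "(((1 - \<beta>) + \<beta> * x powr s) powr (1 / s)) powr s \<le> (1 - \<beta> + \<beta> * x) powr s"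
      using assms by (intro powr_mono2) auto
    then show ?thesis
      using assms xs by (simp add: powr_powr)
  qed
  finally show ?thesis .
qed

text \<open>
  The case \<open>t' \<le> t\<close> of the next lemma. Factoring out \<open>t\<^sup>s\<close> reduces to \<open>t = 1\<close>, because the
  normalised gap \<open>\<gamma> / t\<close> is at least \<open>\<gamma>\<close>.
\<close>
lemma two_piece_bound_aux:
  fixes s :: real
  assumes s: "0 < s" "s \<le> 1" and nn: "0 \<le> \<alpha>" "0 \<le> \<beta>" "0 \<le> \<gamma>" and sum: "\<alpha> + \<gamma> + \<beta> = 1"
    and p: "\<beta> \<le> q" "q \<le> 1"
    and t: "0 \<le> t'" "t' \<le> t" "t \<le> 1"
  shows "(1 - q) * t powr s + q * t' powr s \<le> (\<alpha> * t + \<gamma> + \<beta> * t') powr s"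
proof (cases "t = 0")
  case False
  then have "0 < t" using t by simp
  define x where "x = t' / t"
  have x: "0 \<le> x" "x \<le> 1" "t' = t * x"
    using t \<open>0 < t\<close> by (auto simp: x_def)
  have "(1 - q) * t powr s + q * t' powr s = t powr s * (1 - q + q * x powr s)"
    using x \<open>0 < t\<close> by (simp add: powr_mult algebra_simps)
  also have "\<dots> \<le> t powr s * (1 - \<beta> + \<beta> * x) powr s"
    using assms x by (intro mult_left_mono powr_affine_bound) auto
  also have "\<dots> = (t * (1 - \<beta>) + \<beta> * t') powr s"
    using x \<open>0 < t\<close> nn sum by (simp add: powr_mult[symmetric] algebra_simps)
  also have "\<dots> \<le> (\<alpha> * t + \<gamma> + \<beta> * t') powr s"
  proof (rule powr_mono2)
    have "\<gamma> * t \<le> \<gamma>"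
      using nn t by (simp add: mult_left_le)
    then show "t * (1 - \<beta>) + \<beta> * t' \<le> \<alpha> * t + \<gamma> + \<beta> * t'"
      using sum by (simp add: algebra_simps flip: sum)
    show "0 \<le> t * (1 - \<beta>) + \<beta> * t'"
      using nn sum t by auto
  qed (use s in auto)
  finally show ?thesis .
qed (use t in auto)

text \<open>
  The unit interval is cut into pieces of lengths \<open>\<alpha>\<close> and \<open>\<beta>\<close> with a gap \<open>\<gamma>\<close> in between, and
  the pieces carry masses \<open>p\<close> and \<open>q\<close>. An interval across the gap that takes the fractions
  \<open>t\<close> and \<open>t'\<close> of the two pieces has mass at most the left-hand side, if each piece obeys the
  \<open>s\<close>-power bound internally. The bound is inherited by the whole as soon as
  each piece carries at least its share of the mass.
\<close>
lemma two_piece_bound: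
  fixes s :: real
  assumes s: "0 < s" "s \<le> 1" and nn: "0 \<le> \<alpha>" "0 \<le> \<beta>" "0 \<le> \<gamma>" and sum: "\<alpha> + \<gamma> + \<beta> = 1"
    and p: "p + q = 1" "\<alpha> \<le> p" "\<beta> \<le> q"
    and t: "0 \<le> t" "t \<le> 1" "0 \<le> t'" "t' \<le> 1"
  shows "p * t powr s + q * t' powr s \<le> (\<alpha> * t + \<gamma> + \<beta> * t') powr s"
proof (cases "t' \<le> t")
  case True
  have "p = 1 - q" "q \<le> 1" using p nn by auto
  then show ?thesis
    unfolding \<open>p = 1 - q\<close> using assms True by (intro two_piece_bound_aux) auto
next
  case False
  have "q = 1 - p" "p \<le> 1" using p nn by auto
  then show ?thesis
    unfolding \<open>q = 1 - p\<close>
    using two_piece_bound_aux[of s \<beta> \<alpha> \<gamma> p t t'] assms False by (simp add: algebra_simps)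
qed

text \<open>
  The same for total mass \<open>R \<le> 1\<close>, when the left piece is known to obey the bound \<open>t\<^sup>s\<close>, not
  \<open>R t\<^sup>s\<close>. Its mass never exceeds \<open>R\<close>, so it may be written as \<open>R \<tau>\<^sup>s\<close> with
  \<open>\<tau> \<le> 1\<close>; dividing by \<open>R\<close> then turns lengths \<open>z\<close> into \<open>z / R\<^sup>1\<^sup>/\<^sup>s \<ge> z\<close>.
\<close>
lemma capped_two_piece_bound:
  fixes s :: real
  assumes s: "0 < s" "s \<le> 1" and nn: "0 \<le> \<alpha>" "0 \<le> \<beta>" "0 \<le> \<gamma>" and sum: "\<alpha> + \<gamma> + \<beta> = 1"
    and p: "p + q = 1" "\<alpha> \<le> p" "\<beta> \<le> q"
    and t: "0 \<le> t" "0 \<le> t'" "t' \<le> 1" and R: "0 < R" "R \<le> 1"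
  shows "p * min R (t powr s) + R * q * t' powr s \<le> (\<alpha> * t + \<gamma> + \<beta> * t') powr s"
proof -
  define m where "m = min R (t powr s)"
  define \<tau> where "\<tau> = (m / R) powr (1 / s)"
  define \<rho> where "\<rho> = R powr (1 / s)"
  have m: "0 \<le> m" "m \<le> R" "m \<le> t powr s" using R by (auto simp: m_def)
  have \<tau>: "0 \<le> \<tau>" "\<tau> \<le> 1" "\<tau> powr s = m / R"
    using m R s by (auto simp: \<tau>_def powr_powr intro: powr_le1)
  have \<rho>: "0 \<le> \<rho>" "\<rho> \<le> 1" "\<rho> powr s = R"
    using R s by (auto simp: \<rho>_def powr_powr intro: powr_le1)
  have "\<rho> * \<tau> = m powr (1 / s)"
    using m R by (simp add: \<rho>_def \<tau>_def powr_divide)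
  also have "\<dots> \<le> (t powr s) powr (1 / s)"
    using m s by (intro powr_mono2) auto
  also have "\<dots> = t" using t s by (simp add: powr_powr)
  finally have \<rho>\<tau>: "\<rho> * \<tau> \<le> t" .
  have "p * m + R * q * t' powr s = R * (p * \<tau> powr s + q * t' powr s)"
    using R by (simp add: \<tau> algebra_simps)
  also have "\<dots> \<le> R * (\<alpha> * \<tau> + \<gamma> + \<beta> * t') powr s"
    using assms \<tau> by (intro mult_left_mono two_piece_bound) auto
  also have "\<dots> = (\<rho> * (\<alpha> * \<tau> + \<gamma> + \<beta> * t')) powr s"
    using \<rho> \<tau> nn t by (subst powr_mult) auto
  also have "\<dots> \<le> (\<alpha> * t + \<gamma> + \<beta> * t') powr s"
  proof (rule powr_mono2)
    have "\<alpha> * (\<rho> * \<tau>) \<le> \<alpha> * t" "\<rho> * (\<gamma> + \<beta> * t') \<le> \<gamma> + \<beta> * t'"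
      using \<rho>\<tau> \<rho> nn t by (auto intro!: mult_left_mono mult_left_le_one_le)
    then show "\<rho> * (\<alpha> * \<tau> + \<gamma> + \<beta> * t') \<le> \<alpha> * t + \<gamma> + \<beta> * t'"
      by (simp add: algebra_simps)
  qed (use \<rho> \<tau> nn t s in auto)
  finally show ?thesis unfolding m_def .
qed

text \<open>
  For a bound that is known up to an additive error, improving the error by a fixed factor
  makes it arbitrarily small.
\<close>
lemma contracting_error:
  fixes P :: "real \<Rightarrow> bool"
  assumes "P 1" "\<And>E. 0 < E \<Longrightarrow> P E \<Longrightarrow> P (q * E)" "0 < q" "q < 1" "0 < e"
  shows "\<exists>E. 0 < E \<and> E < e \<and> P E"
proof -
  obtain n where "q ^ n < e"
    using assms real_arch_pow_inv by blast
  moreover have "P (q ^ n)"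
    by (induction n) (use assms in auto)
  ultimately show ?thesis using assms by (intro exI[of _ "q ^ n"]) auto
qed

text \<open>
  A bound with error \<open>E\<close> inside a piece of ratio \<open>k\<close>, transported to the whole set: the power
  term is reproduced and the error shrinks.
\<close>
lemma rescaled_piece:
  fixes s :: real
  assumes "0 < k" "0 < s" "W \<le> z powr s + E" "0 \<le> z" "k * z \<le> d" "k powr s \<le> q" "0 \<le> E"
  shows "k powr s * W \<le> d powr s + q * E"
proof -
  have "k powr s * W \<le> k powr s * z powr s + k powr s * E"
    using assms mult_left_mono[of W "z powr s + E" "k powr s"] by (simp add: algebra_simps)
  moreover have "k powr s * z powr s \<le> d powr s"
    using assms by (auto simp flip: powr_mult intro!: powr_mono2)
  moreover have "k powr s * E \<le> q * E"
    using assms by (intro mult_right_mono)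
  ultimately show ?thesis by linarith
qed

text \<open>
  \<open>U x y\<close> and \<open>V x y\<close> stand for the masses that \<open>[x,y]\<close> receives from the first and the second
  attractor, normalised so that the total masses are \<open>1\<close> and \<open>R\<close>; the step assumptions are the
  self-similarity of the two sets.

  An interval inside one piece is handled by rescaling. An interval across the central gap
  splits into a final part of the left and an initial part of the right piece, and
  \<open>two_piece_bound\<close> applies if initial parts of the second attractor obey the better
  bound \<open>R y\<^sup>s\<close>. So initial intervals \<open>[0,y]\<close> are treated first. They form a closed system:
  an initial interval across the gap contains the whole left piece, and what it takes from
  the right piece is again initial. Each step contracts the error, because at most one of the
  two pieces contributes to it.
\<close>
lemma density_bound:
  fixes U V :: "real \<Rightarrow> real \<Rightarrow> real" and a b c s R :: real
  assumes s: "0 < s" "s \<le> 1"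
    and pos: "0 < a" "0 < b" "0 < c" and gaps: "a + b < 1" "c + b < 1"
    and R: "0 < R" "R \<le> 1"
    and eq_u: "a powr s + b powr s * R = 1" and eq_v: "c powr s * R + b powr s = R"
    and cond: "b \<le> 1 - a powr s"
    and U_step: "\<And>x y. 0 \<le> x \<Longrightarrow> x \<le> y \<Longrightarrow> y \<le> 1 \<Longrightarrow>
      U x y \<le> (if x \<le> a then a powr s * U (x / a) (min 1 (y / a)) else 0)
        + (if 1 - b \<le> y then b powr s * V (max 0 ((x - (1 - b)) / b)) ((y - (1 - b)) / b) else 0)"
    and V_step: "\<And>x y. 0 \<le> x \<Longrightarrow> x \<le> y \<Longrightarrow> y \<le> 1 \<Longrightarrow>
      V x y \<le> (if x \<le> c then c powr s * V (x / c) (min 1 (y / c)) else 0)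
        + (if 1 - b \<le> y then b powr s * U (max 0 ((x - (1 - b)) / b)) ((y - (1 - b)) / b) else 0)"
    and U_le: "\<And>x y. U x y \<le> 1" and V_le: "\<And>x y. V x y \<le> R"
    and xy: "0 \<le> x" "x \<le> y" "y \<le> 1"
  shows "U x y \<le> (y - x) powr s"
proof -
  define q where "q = Max {a powr s, b powr s, c powr s}"
  have less1: "a powr s < 1" "b powr s < 1" "c powr s < 1"
    using s pos gaps powr_less_mono2[of s _ 1] by auto
  have q: "0 < q" "q < 1" "a powr s \<le> q" "b powr s \<le> q" "c powr s \<le> q"
    using less1 pos by (auto simp: q_def max_def)
  have bs: "b powr s = R * (1 - c powr s)"
    using eq_v by (simp add: algebra_simps)
  \<comment> \<open>since \<open>R \<le> 1\<close>, the right piece of the second attractor carries an even larger share of its mass\<close>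
  have "1 - a powr s \<le> 1 - c powr s"
  proof -
    have "1 - a powr s = R * (R * (1 - c powr s))"
      using eq_u bs by (simp add: algebra_simps)
    also have "\<dots> \<le> 1 - c powr s"
      using R less1 by (intro order_trans[OF mult_left_le_one_le] mult_left_le_one_le) auto
    finally show ?thesis .
  qed
  then have cond_v: "b \<le> 1 - c powr s" using cond by simp
  have a_le: "a \<le> a powr s" "c \<le> c powr s"
    using powr_mono'[of s 1 a] powr_mono'[of s 1 c] s pos gaps by auto
  have u_bound: "a powr s * t powr s + b powr s * R * t' powr s \<le> (a * t + (1 - a - b) + b * t') powr s"
    if "0 \<le> t" "t \<le> 1" "0 \<le> t'" "t' \<le> 1" for t t'
    using that s pos gaps eq_u cond a_le by (intro two_piece_bound) auto
  have v_bound: "c powr s * t powr s + (1 - c powr s) * t' powr s \<le> (c * t + (1 - c - b) + b * t') powr s"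
    if "0 \<le> t" "t \<le> 1" "0 \<le> t'" "t' \<le> 1" for t t'
    using that s pos gaps cond_v a_le by (intro two_piece_bound) auto
  have v_bound': "c powr s * min R (t powr s) + b powr s * t' powr s \<le> (c * t + (1 - c - b) + b * t') powr s"
    if "0 \<le> t" "0 \<le> t'" "t' \<le> 1" for t t'
    unfolding bs using that s pos gaps cond_v a_le R by (intro capped_two_piece_bound) auto
  define init where "init E \<longleftrightarrow> (\<forall>y. 0 \<le> y \<and> y \<le> 1 \<longrightarrow>
      U 0 y \<le> y powr s + E \<and> V 0 y \<le> R * y powr s + E)" for E
  have "init 1"
    using U_le order_trans[OF V_le R(2)] R by (simp add: init_def add_increasing)
  moreover have "init (q * E)" if E: "0 < E" "init E" for E
    unfolding init_def
  proof safe
    fix y :: real assume y: "0 \<le> y" "y \<le> 1"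
    define y' where "y' = (y - (1 - b)) / b"
    have y': "y' \<le> 1" "b * y' = y - (1 - b)" "1 - b \<le> y \<Longrightarrow> 0 \<le> y'" 
      using y pos by (auto simp: y'_def field_simps)
    have IH: "U 0 z \<le> z powr s + E" "V 0 z \<le> R * z powr s + E" if "0 \<le> z" "z \<le> 1" for z
      using E that by (auto simp: init_def)
    show "U 0 y \<le> y powr s + q * E"
    proof (cases "1 - b \<le> y")
      case True
      then have "U 0 y \<le> a powr s * U 0 1 + b powr s * V 0 y'"
        using U_step[of 0 y] y pos gaps by (simp add: y'_def min_def field_simps)
      also have "\<dots> \<le> a powr s * 1 + b powr s * (R * y' powr s + E)"
        using U_le IH(2)[of y'] y' True by (intro add_mono mult_left_mono) auto
      also have "\<dots> \<le> (a * 1 + (1 - a - b) + b * y') powr s + b powr s * E"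
        using u_bound[of 1 y'] y' True by (simp add: algebra_simps)
      also have "\<dots> \<le> y powr s + q * E"
        using y' q E by (auto intro!: mult_right_mono)
      finally show ?thesis .
    next
      case False
      then have "U 0 y \<le> a powr s * U 0 (min 1 (y / a))"
        using U_step[of 0 y] y pos by simp
      also have "\<dots> \<le> y powr s + q * E"
        using IH(1)[of "min 1 (y / a)"] y pos q E s
        by (intro rescaled_piece[of _ _ _ "min 1 (y / a)"]) (auto simp: min_def field_simps)
      finally show ?thesis .
    qed
    show "V 0 y \<le> R * y powr s + q * E"
    proof (cases "1 - b \<le> y")
      case True
      then have "V 0 y \<le> c powr s * V 0 1 + b powr s * U 0 y'"
        using V_step[of 0 y] y pos gaps by (simp add: y'_def min_def field_simps)
      also have "\<dots> \<le> c powr s * R + b powr s * (y' powr s + E)"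
        using V_le IH(1)[of y'] y' True by (intro add_mono mult_left_mono) auto
      also have "\<dots> = R * (c powr s * 1 powr s + (1 - c powr s) * y' powr s) + b powr s * E"
        by (simp add: bs algebra_simps)
      also have "\<dots> \<le> R * (c * 1 + (1 - c - b) + b * y') powr s + b powr s * E"
        using v_bound[of 1 y'] y' True R by (intro add_mono mult_left_mono) auto
      also have "\<dots> \<le> R * y powr s + q * E"
        using y' q E by (auto intro!: mult_right_mono)
      finally show ?thesis .
    next
      case False
      define z where "z = min 1 (y / c)"
      have z: "0 \<le> z" "z \<le> 1" "c * z \<le> y"
        using y pos by (auto simp: z_def min_def field_simps)
      have "V 0 y \<le> c powr s * V 0 z"
        using V_step[of 0 y] y pos False by (simp add: z_def)
      also have "\<dots> \<le> c powr s * (R * z powr s + E)"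
        using IH(2)[of z] z by (intro mult_left_mono) auto
      also have "\<dots> = R * (c * z) powr s + c powr s * E"
        using z pos by (simp add: powr_mult algebra_simps)
      also have "\<dots> \<le> R * y powr s + q * E"
        using z q E R pos s by (intro add_mono mult_left_mono mult_right_mono powr_mono2) auto
      finally show ?thesis .
    qed
  qed
  ultimately have init: "\<exists>E. 0 < E \<and> E < e \<and> init E" if "0 < e" for e
    using contracting_error[of init q e] q that by blast
  have init_u: "U 0 y \<le> y powr s" and init_v: "V 0 y \<le> R * y powr s" if "0 \<le> y" "y \<le> 1" for y
    by (rule field_le_epsilon, use init that in \<open>force simp: init_def\<close>)+
  \<comment> \<open>an interval across the gap meets the right piece in an initial part, which enters without an error now\<close>
  define all where "all E \<longleftrightarrow> (\<forall>x y. 0 \<le> x \<and> x \<le> y \<and> y \<le> 1 \<longrightarrow>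
      U x y \<le> (y - x) powr s + E \<and> V x y \<le> (y - x) powr s + E)" for E
  have "all 1"
    using U_le order_trans[OF V_le R(2)] R by (simp add: all_def add_increasing)
  moreover have "all (q * E)" if E: "0 < E" "all E" for E
    unfolding all_def
  proof safe
    fix x y :: real assume xy: "0 \<le> x" "x \<le> y" "y \<le> 1"
    define y' x' where "y' = (y - (1 - b)) / b" and "x' = max 0 ((x - (1 - b)) / b)"
    have y': "y' \<le> 1" "b * y' = y - (1 - b)" "1 - b \<le> y \<Longrightarrow> 0 \<le> y'"
      using xy pos by (auto simp: y'_def field_simps)
    define z where "z = (x - (1 - b)) / b"
    have z: "b * z = x - (1 - b)" and x'_eq: "x' = max 0 z"
      using pos by (auto simp: z_def x'_def)
    have "z \<le> y'"
      using xy pos by (auto simp: z_def y'_def intro!: divide_right_mono)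
    moreover have "b * z \<le> b * x'"
      using pos by (intro mult_left_mono) (auto simp: x'_eq)
    moreover have "z \<le> 0" if "x \<le> 1 - b"
      using that pos by (auto simp: z_def field_simps)
    ultimately have x': "0 \<le> x'" "1 - b \<le> y \<Longrightarrow> x' \<le> y'" "b * (y' - x') \<le> y - x" "x \<le> 1 - b \<Longrightarrow> x' = 0"
      using y' z by (auto simp: x'_eq right_diff_distrib)
    have IH: "U w z \<le> (z - w) powr s + E" "V w z \<le> (z - w) powr s + E"
      if "0 \<le> w" "w \<le> z" "z \<le> 1" for w z
      using E that by (auto simp: all_def)
    have left: "0 \<le> x / k" "x / k \<le> min 1 (y / k)" "min 1 (y / k) \<le> 1"
        "k * (min 1 (y / k) - x / k) \<le> y - x" if "0 < k" "x \<le> k" for k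
      using that xy by (auto simp: min_def field_simps)
    have nonneg: "0 \<le> (y - x) powr s + q * E"
      using q E by (intro add_nonneg_nonneg) auto
    show "U x y \<le> (y - x) powr s + q * E"
    proof -
      consider "x \<le> a" "y < 1 - b" | "x \<le> a" "1 - b \<le> y" | "a < x" "y < 1 - b" | "a < x" "1 - b \<le> y"
        by linarith
      then show ?thesis
      proof cases
        case 1
        then have "U x y \<le> a powr s * U (x / a) (min 1 (y / a))"
          using U_step[OF xy] by simp
        also have "\<dots> \<le> (y - x) powr s + q * E"
          using IH(1) left[of a] 1 pos s q E by (intro rescaled_piece) auto
        finally show ?thesis .
      next
        case 2
        define t where "t = 1 - x / a"
        have t: "0 \<le> t" "t \<le> 1" "a * t = a - x"
          using 2 xy pos by (auto simp: t_def field_simps)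
        have "U x y \<le> a powr s * U (x / a) 1 + b powr s * V 0 y'"
          using U_step[OF xy] 2 pos gaps x'(4) by (simp add: y'_def x'_def min_def field_simps)
        also have "\<dots> \<le> a powr s * (t powr s + E) + b powr s * (R * y' powr s)"
          using IH(1)[of "x / a" 1] init_v[of y'] y' 2 left[of a] pos xy
          by (intro add_mono mult_left_mono) (auto simp: t_def)
        also have "\<dots> \<le> (a * t + (1 - a - b) + b * y') powr s + a powr s * E"
          using u_bound[of t y'] y'(1,3) t(1,2) 2(2) by (simp add: distrib_left)
        also have "a * t + (1 - a - b) + b * y' = y - x"
          using y'(2) t(3) by simp
        also have "(y - x) powr s + a powr s * E \<le> (y - x) powr s + q * E"
          using q E by (auto intro!: mult_right_mono)
        finally show ?thesis .
      next
        case 3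
        then show ?thesis using U_step[OF xy] nonneg by simp
      next
        case 4
        then have "U x y \<le> b powr s * V x' y'"
          using U_step[OF xy] by (simp add: x'_def y'_def)
        also have "\<dots> \<le> (y - x) powr s + q * E"
          using IH(2) x' y' 4 pos s q E by (intro rescaled_piece) auto
        finally show ?thesis .
      qed
    qed
    show "V x y \<le> (y - x) powr s + q * E"
    proof -
      consider "x \<le> c" "y < 1 - b" | "x \<le> c" "1 - b \<le> y" | "c < x" "y < 1 - b" | "c < x" "1 - b \<le> y"
        by linarith
      then show ?thesis
      proof cases
        case 1
        then have "V x y \<le> c powr s * V (x / c) (min 1 (y / c))"
          using V_step[OF xy] by simp
        also have "\<dots> \<le> (y - x) powr s + q * E"
          using IH(2) left[of c] 1 pos s q E by (intro rescaled_piece) auto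
        finally show ?thesis .
      next
        case 2
        define t where "t = 1 - x / c"
        have t: "0 \<le> t" "t \<le> 1" "c * t = c - x"
          using 2 xy pos by (auto simp: t_def field_simps)
        have "V x y \<le> c powr s * V (x / c) 1 + b powr s * U 0 y'"
          using V_step[OF xy] 2 pos gaps x'(4) by (simp add: y'_def x'_def min_def field_simps)
        also have "\<dots> \<le> c powr s * (min R (t powr s) + E) + b powr s * y' powr s"
        proof (intro add_mono mult_left_mono)
          have "V (x / c) 1 \<le> t powr s + E"
            using IH(2)[of "x / c" 1] left[of c] 2 pos xy by (auto simp: t_def)
          then show "V (x / c) 1 \<le> min R (t powr s) + E"
            using V_le[of "x / c" 1] E by (auto simp: min_def)
        qed (use init_u y' 2 in auto)
        also have "\<dots> \<le> (c * t + (1 - c - b) + b * y') powr s + c powr s * E"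
          using v_bound'[of t y'] y'(1,3) t(1,2) 2(2) by (simp add: distrib_left)
        also have "c * t + (1 - c - b) + b * y' = y - x"
          using y'(2) t(3) by simp
        also have "(y - x) powr s + c powr s * E \<le> (y - x) powr s + q * E"
          using q E by (auto intro!: mult_right_mono)
        finally show ?thesis .
      next
        case 3
        then show ?thesis using V_step[OF xy] nonneg by simp
      next
        case 4
        then have "V x y \<le> b powr s * U x' y'"
          using V_step[OF xy] by (simp add: x'_def y'_def)
        also have "\<dots> \<le> (y - x) powr s + q * E"
          using IH(1) x' y' 4 pos s q E by (intro rescaled_piece) auto
        finally show ?thesis .
      qed
    qed
  qed
  ultimately have all: "\<exists>E. 0 < E \<and> E < e \<and> all E" if "0 < e" for e
    using contracting_error[of all q e] q that by blast
  show ?thesis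
    by (rule field_le_epsilon, use all xy in \<open>force simp: all_def\<close>)
qed

section \<open>Dimension and measure of the two attractors\<close>

text \<open>
  The right-hand maps \<open>x \<mapsto> b x + a + g\<^sub>u\<close> and \<open>x \<mapsto> b x + c + g\<^sub>v\<close> are the same function
  \<open>x \<mapsto> b x + (1 - b)\<close>. Written this way, the situation is symmetric under exchanging
  the two vertices, so that facts about the first attractor transfer to the second.
\<close>
locale two_vertex_IFS =
  fixes a gu b c gv :: real and Fu Fv :: "real set"
  assumes pos: "0 < a" "0 < gu" "0 < b" "0 < c" "0 < gv"
    and sum_u: "a + gu + b = 1" and sum_v: "c + gv + b = 1"
    and compact_u: "compact Fu" and compact_v: "compact Fv"
    and nonempty_u: "Fu \<noteq> {}" and nonempty_v: "Fv \<noteq> {}"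
    and Fu_eq: "Fu = (\<lambda>x. a * x) ` Fu \<union> (\<lambda>x. b * x + (1 - b)) ` Fv"
    and Fv_eq: "Fv = (\<lambda>x. c * x) ` Fv \<union> (\<lambda>x. b * x + (1 - b)) ` Fu"
begin

lemma swap: "two_vertex_IFS c gv b a gu Fv Fu"
  by unfold_locales (fact pos sum_u sum_v compact_u compact_v nonempty_u nonempty_v Fu_eq Fv_eq)+

lemma less_one: "a < 1" "b < 1" "c < 1" "a < 1 - b" "c < 1 - b"
  using pos sum_u sum_v by auto

lemma left_in_u:
  assumes "x \<in> Fu"
  shows "a * x \<in> Fu"
proof -
  have "a * x \<in> (\<lambda>x. a * x) ` Fu \<union> (\<lambda>x. b * x + (1 - b)) ` Fv"
    using assms by (intro UnI1 imageI)
  then show ?thesis unfolding Fu_eq[symmetric] .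
qed

lemma right_in_u:
  assumes "x \<in> Fv"
  shows "b * x + (1 - b) \<in> Fu"
proof -
  have "b * x + (1 - b) \<in> (\<lambda>x. a * x) ` Fu \<union> (\<lambda>x. b * x + (1 - b)) ` Fv"
    using assms by (intro UnI2 imageI)
  then show ?thesis unfolding Fu_eq[symmetric] .
qed

lemma Fu_cases:
  assumes "x \<in> Fu"
  obtains x' where "x' \<in> Fu" "x = a * x'" | x' where "x' \<in> Fv" "x = b * x' + (1 - b)"
proof -
  have "x \<in> (\<lambda>x. a * x) ` Fu \<union> (\<lambda>x. b * x + (1 - b)) ` Fv"
    unfolding Fu_eq[symmetric] by (rule assms)
  then show thesis using that by (elim UnE imageE) auto
qed

text \<open>
  The largest and smallest elements of the two sets satisfy the inequalities coming
  from the four maps, whose fixed points are \<open>0\<close> and \<open>1\<close>.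
\<close>
lemma extrema: "Fu \<subseteq> {0..1} \<and> Fv \<subseteq> {0..1} \<and> 0 \<in> Fu \<and> 1 \<in> Fu"
proof -
  interpret swap: two_vertex_IFS c gv b a gu Fv Fu by (rule swap)
  obtain M where M: "M \<in> Fu" "\<And>x. x \<in> Fu \<Longrightarrow> x \<le> M"
    using compact_attains_sup[OF compact_u nonempty_u] by blast
  obtain N where N: "N \<in> Fv" "\<And>x. x \<in> Fv \<Longrightarrow> x \<le> N"
    using compact_attains_sup[OF compact_v nonempty_v] by blast
  obtain m where m: "m \<in> Fu" "\<And>x. x \<in> Fu \<Longrightarrow> m \<le> x"
    using compact_attains_inf[OF compact_u nonempty_u] by blast
  obtain n where n: "n \<in> Fv" "\<And>x. x \<in> Fv \<Longrightarrow> n \<le> x"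
    using compact_attains_inf[OF compact_v nonempty_v] by blast
  have shrink: "k * z \<le> k * w" if "0 < k" "z \<le> w" for k z w :: real
    using that by simp
  have lt: "k * z < z" if "0 < z" "k < 1" for k z :: real
    using that by simp
  have gt: "z < k * z" if "z < 0" "k < 1" for k z :: real
    using that by simp
  have M_le: "M \<le> 0 \<or> M \<le> b * N + (1 - b)"
  proof -
    from M(1) show ?thesis
    proof (cases rule: Fu_cases)
      case (1 x')
      then show ?thesis using M(2)[of x'] shrink[of a x' M] lt[of M a] pos less_one by linarith
    next
      case (2 x')
      then show ?thesis using N(2)[of x'] shrink[of b x' N] pos by linarith
    qed
  qed
  have N_le: "N \<le> 0 \<or> N \<le> b * M + (1 - b)"
  proof -
    from N(1) show ?thesis
    proof (cases rule: swap.Fu_cases)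
      case (1 x')
      then show ?thesis using N(2)[of x'] shrink[of c x' N] lt[of N c] pos less_one by linarith
    next
      case (2 x')
      then show ?thesis using M(2)[of x'] shrink[of b x' M] pos by linarith
    qed
  qed
  have m_ge: "0 \<le> m \<or> b * n + (1 - b) \<le> m"
  proof -
    from m(1) show ?thesis
    proof (cases rule: Fu_cases)
      case (1 x')
      then show ?thesis using m(2)[of x'] shrink[of a m x'] gt[of m a] pos less_one by linarith
    next
      case (2 x')
      then show ?thesis using n(2)[of x'] shrink[of b n x'] pos by linarith
    qed
  qed
  have n_ge: "0 \<le> n \<or> b * m + (1 - b) \<le> n"
  proof -
    from n(1) show ?thesis
    proof (cases rule: swap.Fu_cases)
      case (1 x')
      then show ?thesis using n(2)[of x'] shrink[of c n x'] gt[of n c] pos less_one by linarith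
    next
      case (2 x')
      then show ?thesis using m(2)[of x'] shrink[of b m x'] pos by linarith
    qed
  qed
  have b_mono: "b * z \<le> b * w" if "z \<le> w" for z w using that pos by simp
  have b_lt: "b * z + (1 - b) < z" if "1 < z" for z
  proof -
    have "0 < (1 - b) * (z - 1)" using that less_one by simp
    then show ?thesis by (simp add: algebra_simps)
  qed
  have b_gt: "z < b * z + (1 - b)" if "z < 1" for z
  proof -
    have "0 < (1 - b) * (1 - z)" using that less_one by simp
    then show ?thesis by (simp add: algebra_simps)
  qed
  have MN: "M \<le> 1" "N \<le> 1"
  proof -
    have "max M N \<le> 1"
      using M_le N_le b_mono[of N M] b_mono[of M N] b_lt[of M] b_lt[of N] by linarith
    then show "M \<le> 1" "N \<le> 1" by auto
  qed
  have mn: "0 \<le> m" "0 \<le> n"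
  proof -
    have "0 \<le> min m n"
      using m_ge n_ge b_mono[of n m] b_mono[of m n] b_gt[of m] b_gt[of n] by linarith
    then show "0 \<le> m" "0 \<le> n" by auto
  qed
  have "m \<le> a * m" using m left_in_u by blast
  then have "m = 0"
    using lt[of m a] less_one mn by linarith
  have "b * N + (1 - b) \<le> M" "b * M + (1 - b) \<le> N"
    using M N right_in_u swap.right_in_u by blast+
  then have "M = 1"
    using MN b_gt[of M] b_gt[of N] by (smt (verit) b_mono)
  have "Fu \<subseteq> {0..1}" "Fv \<subseteq> {0..1}"
    using M(2) N(2) m(2) n(2) MN mn by (meson atLeastAtMost_iff order_trans subsetI)+
  with \<open>M = 1\<close> \<open>m = 0\<close> M(1) m(1) show ?thesis by simp
qed

lemma bounds_u: "x \<in> Fu \<Longrightarrow> 0 \<le> x" "x \<in> Fu \<Longrightarrow> x \<le> 1"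
  and zero_in_u: "0 \<in> Fu" and one_in_u: "1 \<in> Fu"
  using extrema by auto

lemma left_bounds:
  assumes "x \<in> Fu"
  shows "0 \<le> a * x" "a * x \<le> a"
  using bounds_u[OF assms] pos(1) by (simp_all add: mult_left_le)

lemma right_bounds:
  assumes "x \<in> Fv"
  shows "1 - b \<le> b * x + (1 - b)" "b * x + (1 - b) \<le> 1"
proof -
  interpret swap: two_vertex_IFS c gv b a gu Fv Fu by (rule swap)
  show "1 - b \<le> b * x + (1 - b)" "b * x + (1 - b) \<le> 1"
    using swap.bounds_u[OF assms] pos(3) by (simp_all add: mult_left_le)
qed

lemma Fu_left:
  assumes "x \<in> Fu" "x < 1 - b"
  shows "x / a \<in> Fu" "x \<le> a"
proof -
  have "x / a \<in> Fu \<and> x \<le> a"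
    using assms(1)
  proof (cases rule: Fu_cases)
    case (1 x')
    then show ?thesis using left_bounds[of x'] pos(1) by simp
  next
    case (2 x')
    then show ?thesis using right_bounds[of x'] assms(2) by simp
  qed
  then show "x / a \<in> Fu" "x \<le> a" by auto
qed

lemma Fu_right:
  assumes "x \<in> Fu" "a < x"
  shows "(x - (1 - b)) / b \<in> Fv" "1 - b \<le> x"
proof -
  have "(x - (1 - b)) / b \<in> Fv \<and> 1 - b \<le> x"
    using assms(1)
  proof (cases rule: Fu_cases)
    case (1 x')
    then show ?thesis using left_bounds[of x'] assms(2) by simp
  next
    case (2 x')
    then show ?thesis using right_bounds[of x'] pos(3) by simp
  qed
  then show "(x - (1 - b)) / b \<in> Fv" "1 - b \<le> x" by auto
qed

lemma sim_left: "dist (a * x) (a * y) = a * dist x y"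
proof -
  have "a * x - a * y = a * (x - y)" by (simp add: algebra_simps)
  then show ?thesis using pos by (simp add: dist_real_def abs_mult)
qed

lemma sim_right: "dist (b * x + (1 - b)) (b * y + (1 - b)) = b * dist x y"
proof -
  have "b * x + (1 - b) - (b * y + (1 - b)) = b * (x - y)" by (simp add: algebra_simps)
  then show ?thesis unfolding dist_real_def using pos by (simp only: abs_mult abs_of_pos)
qed

lemma hausdorff_measure_u_eq:
  assumes "0 < s"
  shows "hausdorff_measure s Fu
    = ennreal (a powr s) * hausdorff_measure s Fu + ennreal (b powr s) * hausdorff_measure s Fv"
proof -
  have "hausdorff_measure s ((\<lambda>x. a * x) ` Fu \<union> (\<lambda>x. b * x + (1 - b)) ` Fv)
      = hausdorff_measure s ((\<lambda>x. a * x) ` Fu) + hausdorff_measure s ((\<lambda>x. b * x + (1 - b)) ` Fv)"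
  proof (rule hausdorff_measure_Un_separated[OF pos(2)])
    fix x y assume "x \<in> (\<lambda>x. a * x) ` Fu" "y \<in> (\<lambda>x. b * x + (1 - b)) ` Fv"
    then have "x \<le> a" "1 - b \<le> y"
      using left_bounds right_bounds by blast+
    then show "gu \<le> dist x y" using sum_u by (simp add: dist_real_def)
  qed (use assms in simp)
  then show ?thesis
    unfolding Fu_eq[symmetric] hausdorff_measure_similarity[OF sim_left pos(1) assms]
      hausdorff_measure_similarity[OF sim_right pos(3) assms] .
qed

text \<open>
  A set of diameter below the central gap meets only one of the two pieces. Hence such a cover
  splits into covers of the two pieces, which are rescaled to covers of the attractors. Both
  use strictly fewer sets, which makes an induction on the number of sets possible.
\<close>
lemma cover_split:
  fixes U :: "nat \<Rightarrow> real set"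
  assumes "finite I" "Fu \<subseteq> (\<Union>i\<in>I. U i)" "\<And>i. i \<in> I \<Longrightarrow> bounded (U i)"
    and small: "\<And>i. i \<in> I \<Longrightarrow> diameter (U i) < gu" and "0 < s"
  obtains I1 I2 V1 V2 where "I1 \<subset> I" "I2 \<subset> I" "Fu \<subseteq> (\<Union>i\<in>I1. V1 i)" "Fv \<subseteq> (\<Union>i\<in>I2. V2 i)"
    "\<And>i. i \<in> I1 \<Longrightarrow> bounded (V1 i)" "\<And>i. i \<in> I2 \<Longrightarrow> bounded (V2 i)"
    "a powr s * (\<Sum>i\<in>I1. diameter (V1 i) powr s) + b powr s * (\<Sum>i\<in>I2. diameter (V2 i) powr s)
       \<le> (\<Sum>i\<in>I. diameter (U i) powr s)"
proof -
  define I1 I2 where "I1 = {i \<in> I. \<exists>x\<in>U i. x \<le> a}" and "I2 = {i \<in> I. \<exists>x\<in>U i. 1 - b \<le> x}"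
  define V1 V2 where "V1 i = (\<lambda>x. a * x) -` U i" and "V2 i = (\<lambda>x. b * x + (1 - b)) -` U i" for i
  have disj: "I1 \<inter> I2 = {}"
  proof (rule ccontr)
    assume "I1 \<inter> I2 \<noteq> {}"
    then obtain i x y where i: "i \<in> I" "x \<in> U i" "x \<le> a" "y \<in> U i" "1 - b \<le> y"
      by (auto simp: I1_def I2_def)
    then have "dist x y \<le> diameter (U i)"
      using assms by (intro diameter_bounded_bound) auto
    then show False
      using i small[OF i(1)] sum_u by (simp add: dist_real_def)
  qed
  have sub: "I1 \<subseteq> I" "I2 \<subseteq> I" by (auto simp: I1_def I2_def)
  have cov1: "Fu \<subseteq> (\<Union>i\<in>I1. V1 i)"
  proof
    fix x assume "x \<in> Fu"
    then obtain i where "i \<in> I" "a * x \<in> U i" using left_in_u assms(2) by blast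
    then show "x \<in> (\<Union>i\<in>I1. V1 i)"
      using left_bounds[OF \<open>x \<in> Fu\<close>] by (auto simp: I1_def V1_def)
  qed
  have cov2: "Fv \<subseteq> (\<Union>i\<in>I2. V2 i)"
  proof
    fix x assume "x \<in> Fv"
    then obtain i where "i \<in> I" "b * x + (1 - b) \<in> U i" using right_in_u assms(2) by blast
    moreover from this have "i \<in> I2"
      unfolding I2_def using right_bounds(1)[OF \<open>x \<in> Fv\<close>] by blast
    ultimately show "x \<in> (\<Union>i\<in>I2. V2 i)"
      by (auto simp: V2_def)
  qed
  have "I1 \<noteq> {}" "I2 \<noteq> {}" using cov1 cov2 nonempty_u nonempty_v by auto
  then have psub: "I1 \<subset> I" "I2 \<subset> I" using disj sub by blast+
  have diam: "k powr s * diameter V powr s \<le> diameter (U i) powr s"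
    if "diameter V \<le> diameter (U i) / k" "bounded V" "i \<in> I" "0 < k" for k V i
  proof -
    have "k powr s * diameter V powr s = (k * diameter V) powr s"
      using that diameter_ge_0 by (simp add: powr_mult)
    also have "\<dots> \<le> diameter (U i) powr s"
      using that \<open>0 < s\<close> diameter_ge_0[of V] by (intro powr_mono2) (auto simp: field_simps)
    finally show ?thesis .
  qed
  have bd: "bounded (V1 i)" "bounded (V2 i)" if "i \<in> I" for i
    unfolding V1_def V2_def using that assms(3)
      similarity_diameter(3)[OF sim_left pos(1)] similarity_diameter(3)[OF sim_right pos(3)] by blast+
  have "a powr s * (\<Sum>i\<in>I1. diameter (V1 i) powr s) + b powr s * (\<Sum>i\<in>I2. diameter (V2 i) powr s)
      \<le> (\<Sum>i\<in>I1. diameter (U i) powr s) + (\<Sum>i\<in>I2. diameter (U i) powr s)"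
    unfolding sum_distrib_left
  proof (intro add_mono sum_mono diam)
    show "diameter (V1 i) \<le> diameter (U i) / a" if "i \<in> I1" for i
      unfolding V1_def using that sub assms(3) by (intro similarity_diameter(4)[OF sim_left pos(1)]) auto
    show "diameter (V2 i) \<le> diameter (U i) / b" if "i \<in> I2" for i
      unfolding V2_def using that sub assms(3) by (intro similarity_diameter(4)[OF sim_right pos(3)]) auto
  qed (use sub bd pos in auto)
  also have "\<dots> = (\<Sum>i\<in>I1 \<union> I2. diameter (U i) powr s)"
    using sub disj assms(1) by (intro sum.union_disjoint[symmetric]) (auto intro: finite_subset)
  also have "\<dots> \<le> (\<Sum>i\<in>I. diameter (U i) powr s)"
    using sub assms(1) by (intro sum_mono2) auto
  finally show thesis
    using that[OF psub cov1 cov2] bd sub by blast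
qed

text \<open>
  The weights \<open>1\<close> and \<open>R\<close> reproduce themselves when a cover by small sets is split, so the
  bounds pass from the two smaller covers to the given one. A set too large for the splitting
  exceeds the bound by itself.
\<close>
lemma finite_cover_bound:
  assumes s: "0 < s" and R: "0 < R" and eq_u: "a powr s + b powr s * R = 1"
    and eq_v: "c powr s * R + b powr s = R"
    and k: "k \<le> gu powr s" "k * R \<le> gv powr s"
    and "finite (I :: nat set)" "\<And>i. i \<in> I \<Longrightarrow> bounded (U i)"
  shows "(Fu \<subseteq> (\<Union>i\<in>I. U i) \<longrightarrow> k \<le> (\<Sum>i\<in>I. diameter (U i) powr s))
    \<and> (Fv \<subseteq> (\<Union>i\<in>I. U i) \<longrightarrow> k * R \<le> (\<Sum>i\<in>I. diameter (U i) powr s))"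
proof -
  interpret swap: two_vertex_IFS c gv b a gu Fv Fu by (rule swap)
  from assms(7,8) show ?thesis
  proof (induction I arbitrary: U rule: finite_psubset_induct)
    case (psubset I)
    have big: "k' \<le> (\<Sum>i\<in>I. diameter (U i) powr s)"
      if "k' \<le> g powr s" "i \<in> I" "g \<le> diameter (U i)" "0 < g" for k' g i
    proof -
      have "g powr s \<le> diameter (U i) powr s"
        using that s by (intro powr_mono2) auto
      also have "\<dots> \<le> (\<Sum>i\<in>I. diameter (U i) powr s)"
        using that psubset by (intro member_le_sum) auto
      finally show ?thesis using that by simp
    qed
    show ?case
    proof (intro conjI impI)
      assume cov: "Fu \<subseteq> (\<Union>i\<in>I. U i)"
      show "k \<le> (\<Sum>i\<in>I. diameter (U i) powr s)"
      proof (cases "\<exists>i\<in>I. gu \<le> diameter (U i)")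
        case True
        then show ?thesis using big k pos by blast
      next
        case False
        then obtain I1 I2 V1 V2 where split: "I1 \<subset> I" "I2 \<subset> I"
            "Fu \<subseteq> (\<Union>i\<in>I1. V1 i)" "Fv \<subseteq> (\<Union>i\<in>I2. V2 i)"
            "\<And>i. i \<in> I1 \<Longrightarrow> bounded (V1 i)" "\<And>i. i \<in> I2 \<Longrightarrow> bounded (V2 i)"
            "a powr s * (\<Sum>i\<in>I1. diameter (V1 i) powr s) + b powr s * (\<Sum>i\<in>I2. diameter (V2 i) powr s)
               \<le> (\<Sum>i\<in>I. diameter (U i) powr s)"
          using cover_split[OF psubset.hyps cov psubset.prems _ s] by (metis not_le)
        have "k = a powr s * k + b powr s * (k * R)"
          using eq_u by (metis distrib_right mult.assoc mult.commute mult_1)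
        also have "\<dots> \<le> a powr s * (\<Sum>i\<in>I1. diameter (V1 i) powr s) + b powr s * (\<Sum>i\<in>I2. diameter (V2 i) powr s)"
          using psubset.IH[OF split(1,5)] psubset.IH[OF split(2,6)] split(3,4)
          by (intro add_mono mult_left_mono) auto
        finally show ?thesis using split(7) by linarith
      qed
    next
      assume cov: "Fv \<subseteq> (\<Union>i\<in>I. U i)"
      show "k * R \<le> (\<Sum>i\<in>I. diameter (U i) powr s)"
      proof (cases "\<exists>i\<in>I. gv \<le> diameter (U i)")
        case True
        then show ?thesis using big k pos by blast
      next
        case False
        then obtain I1 I2 V1 V2 where split: "I1 \<subset> I" "I2 \<subset> I"
            "Fv \<subseteq> (\<Union>i\<in>I1. V1 i)" "Fu \<subseteq> (\<Union>i\<in>I2. V2 i)"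
            "\<And>i. i \<in> I1 \<Longrightarrow> bounded (V1 i)" "\<And>i. i \<in> I2 \<Longrightarrow> bounded (V2 i)"
            "c powr s * (\<Sum>i\<in>I1. diameter (V1 i) powr s) + b powr s * (\<Sum>i\<in>I2. diameter (V2 i) powr s)
               \<le> (\<Sum>i\<in>I. diameter (U i) powr s)"
          using swap.cover_split[OF psubset.hyps cov psubset.prems _ s] by (metis not_le)
        have "k * R = c powr s * (k * R) + b powr s * k"
          using eq_v by (metis distrib_left mult.assoc mult.commute)
        also have "\<dots> \<le> c powr s * (\<Sum>i\<in>I1. diameter (V1 i) powr s) + b powr s * (\<Sum>i\<in>I2. diameter (V2 i) powr s)"
          using psubset.IH[OF split(1,5)] psubset.IH[OF split(2,6)] split(3,4)
          by (intro add_mono mult_left_mono) auto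
        finally show ?thesis using split(7) by linarith
      qed
    qed
  qed
qed

lemma premeasure_step:
  assumes "0 < s" "a \<le> q" "b \<le> q" "0 < \<delta>"
  shows "hausdorff_premeasure s (q * \<delta>) Fu
    \<le> ennreal (a powr s) * hausdorff_premeasure s \<delta> Fu + ennreal (b powr s) * hausdorff_premeasure s \<delta> Fv"
proof -
  have "hausdorff_premeasure s (q * \<delta>) ((\<lambda>x. a * x) ` Fu \<union> (\<lambda>x. b * x + (1 - b)) ` Fv)
      \<le> hausdorff_premeasure s (q * \<delta>) ((\<lambda>x. a * x) ` Fu)
        + hausdorff_premeasure s (q * \<delta>) ((\<lambda>x. b * x + (1 - b)) ` Fv)"
    by (rule hausdorff_premeasure_Un)
  also have "\<dots> \<le> hausdorff_premeasure s (a * \<delta>) ((\<lambda>x. a * x) ` Fu)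
        + hausdorff_premeasure s (b * \<delta>) ((\<lambda>x. b * x + (1 - b)) ` Fv)"
    using assms by (intro add_mono hausdorff_premeasure_antimono mult_right_mono) auto
  also have "\<dots> \<le> ennreal (a powr s) * hausdorff_premeasure s \<delta> Fu
        + ennreal (b powr s) * hausdorff_premeasure s \<delta> Fv"
    using hausdorff_premeasure_similarity_le[OF sim_left pos(1) assms(1)]
      hausdorff_premeasure_similarity_le[OF sim_right pos(3) assms(1)] by (intro add_mono)
  finally show ?thesis unfolding Fu_eq[symmetric] .
qed

lemma premeasure_one_le: "0 < s \<Longrightarrow> hausdorff_premeasure s 1 Fu \<le> 1"
proof -
  assume s: "0 < s"
  define U where "U i = (if i = 0 then {0..1::real} else {})" for i :: nat
  have "Fu \<subseteq> U 0" using bounds_u by (auto simp: U_def)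
  then have "Fu \<subseteq> (\<Union>i. U i)" by blast
  then have "U \<in> delta_covers 1 Fu"
    by (simp add: delta_covers_def U_def)
  then have "hausdorff_premeasure s 1 Fu \<le> (\<Sum>i. diam_pow s (U i))"
    by (rule hausdorff_premeasure_le)
  also have "\<dots> = (\<Sum>i\<in>{0}. diam_pow s (U i))"
    by (rule suminf_finite) (auto simp: U_def diam_pow_def)
  also have "\<dots> = 1"
    using s by (simp add: U_def diam_pow_def)
  finally show ?thesis .
qed

text \<open>
  The weights \<open>1\<close> and \<open>R\<close> solve the self-similarity equations, so the bounds \<open>K\<close> and \<open>K R\<close>,
  which hold for covers by a single set, are preserved in passing from each attractor to its
  two pieces.
\<close>
lemma hausdorff_measure_upper:
  assumes s: "0 < s" and R: "0 < R" and eq_u: "a powr s + b powr s * R = 1"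
    and eq_v: "c powr s * R + b powr s = R"
    and K: "1 \<le> K" "1 \<le> K * R"
  shows "hausdorff_measure s Fu \<le> ennreal K"
proof -
  interpret swap: two_vertex_IFS c gv b a gu Fv Fu by (rule swap)
  define q where "q = max a (max b c)"
  have q: "0 < q" "q < 1" "a \<le> q" "b \<le> q" "c \<le> q"
    using pos less_one by (auto simp: q_def)
  have pre: "hausdorff_premeasure s (q ^ n) Fu \<le> ennreal K \<and> hausdorff_premeasure s (q ^ n) Fv \<le> ennreal (K * R)" for n
  proof (induction n)
    case 0
    have "(1::ennreal) \<le> ennreal K" "(1::ennreal) \<le> ennreal (K * R)"
      using K ennreal_leI[of 1] by auto
    then show ?case
      using order_trans[OF premeasure_one_le[OF s]] order_trans[OF swap.premeasure_one_le[OF s]] by simp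
  next
    case (Suc n)
    have "hausdorff_premeasure s (q * q ^ n) Fu \<le> ennreal (a powr s) * ennreal K + ennreal (b powr s) * ennreal (K * R)"
      using Suc q by (intro order_trans[OF premeasure_step[OF s]] add_mono mult_left_mono) auto
    also have "\<dots> = ennreal (a powr s * K + b powr s * (K * R))"
      using K R by (simp flip: ennreal_mult ennreal_plus)
    also have "a powr s * K + b powr s * (K * R) = K"
      using eq_u by (metis distrib_right mult.assoc mult.commute mult_1)
    finally have 1: "hausdorff_premeasure s (q ^ Suc n) Fu \<le> ennreal K" by simp
    have "hausdorff_premeasure s (q * q ^ n) Fv \<le> ennreal (c powr s) * ennreal (K * R) + ennreal (b powr s) * ennreal K"
      using Suc q by (intro order_trans[OF swap.premeasure_step[OF s]] add_mono mult_left_mono) auto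
    also have "\<dots> = ennreal (c powr s * (K * R) + b powr s * K)"
      using K R by (simp flip: ennreal_mult ennreal_plus)
    also have "c powr s * (K * R) + b powr s * K = K * R"
      using eq_v by (metis distrib_left mult.assoc mult.commute)
    finally show ?case using 1 by simp
  qed
  show ?thesis
    unfolding hausdorff_measure_def
  proof (rule SUP_least)
    fix \<delta> :: real assume "\<delta> \<in> {0<..}"
    then obtain n where "q ^ n < \<delta>" using real_arch_pow_inv q by (metis greaterThan_iff)
    then show "hausdorff_premeasure s \<delta> Fu \<le> ennreal K"
      using pre[of n] hausdorff_premeasure_antimono[of "q ^ n" \<delta> s Fu] order_trans by fastforce
  qed
qed

text \<open>
  The matrix with rows \<open>(a\<^sup>s, b\<^sup>s)\<close> and \<open>(b\<^sup>s, c\<^sup>s)\<close> has eigenvalue \<open>1\<close> for some \<open>s\<close> strictly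
  between \<open>0\<close> and \<open>1\<close>, by the intermediate value theorem; \<open>(1, R)\<close> is the eigenvector. The
  function \<open>b\<^sup>2\<^sup>s - (1 - a\<^sup>s) (1 - c\<^sup>s)\<close> is negative at \<open>s = 1\<close> because of the gaps, which give
  \<open>b < 1 - a\<close> and \<open>b < 1 - c\<close>.
\<close>
lemma dimension_exponent_exists:
  "\<exists>s R. 0 < s \<and> s < 1 \<and> 0 < R \<and> a powr s + b powr s * R = 1 \<and> c powr s * R + b powr s = R"
proof -
  define \<phi> where "\<phi> t = b powr t * b powr t - (1 - a powr t) * (1 - c powr t)" for t
  have "b * b < (1 - a) * (1 - c)"
    using pos sum_u sum_v less_one by (intro mult_strict_mono) auto
  then have \<phi>1: "\<phi> 1 < 0" using pos by (simp add: \<phi>_def)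
  have \<phi>0: "0 < \<phi> 0" using pos by (simp add: \<phi>_def)
  have "\<exists>t. 0 \<le> t \<and> t \<le> 1 \<and> \<phi> t = 0"
    using \<phi>0 \<phi>1 pos by (intro IVT2') (auto simp: \<phi>_def intro!: continuous_intros)
  then obtain s where s: "0 \<le> s" "s \<le> 1" "\<phi> s = 0" by blast
  with \<phi>0 \<phi>1 have s': "0 < s" "s < 1"
    by (metis less_irrefl order_le_less)+
  define R where "R = (1 - a powr s) / b powr s"
  have "a powr s < 1"
    using powr_less_mono2[of s a 1] s' pos less_one by simp
  then have "0 < R" using pos by (simp add: R_def)
  moreover have "a powr s + b powr s * R = 1"
    using pos by (simp add: R_def)
  moreover have "c powr s * R + b powr s = R"
    using s(3) pos by (simp add: R_def \<phi>_def field_simps)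
  ultimately show ?thesis using s' by blast
qed

lemma measure_positive_finite_at_dim:
  assumes "0 \<le> s" "hausdorff_dim Fu = ennreal s"
  shows "0 < s" "s < 1"
    and "0 < hausdorff_measure s Fu" "hausdorff_measure s Fu < \<infinity>"
    and "0 < hausdorff_measure s Fv" "hausdorff_measure s Fv < \<infinity>"
proof -
  interpret swap: two_vertex_IFS c gv b a gu Fv Fu by (rule swap)
  obtain t R where t: "0 < t" "t < 1" "0 < R" and eq: "a powr t + b powr t * R = 1" "c powr t * R + b powr t = R"
    using dimension_exponent_exists by blast
  \<comment> \<open>a set as long as the central gap contributes at least \<open>k\<close> to a cover of \<open>Fu\<close>, and \<open>k R\<close> to one of \<open>Fv\<close>\<close>
  define k where "k = min (gu powr t) (gv powr t / R)"
  have k: "0 < k" "k \<le> gu powr t" "k * R \<le> gv powr t"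
    using t pos by (auto simp: k_def min_def field_simps)
  have "ennreal k \<le> hausdorff_measure t Fu" "ennreal (k * R) \<le> hausdorff_measure t Fv"
    using finite_cover_bound[OF t(1,3) eq k(2,3)] t
    by (intro hausdorff_measure_ge_finite_covers compact_u compact_v; blast)+
  then have pos_t: "0 < hausdorff_measure t Fu" "0 < hausdorff_measure t Fv"
    using k t by (auto simp: less_le_trans[of 0 "ennreal k"] less_le_trans[of 0 "ennreal (k * R)"])
  define K where "K = max 1 (1 / R)"
  have K: "1 \<le> K" "1 \<le> K * R"
    using t by (auto simp: K_def max_def field_simps)
  have eq': "c powr t + b powr t * (1 / R) = 1" "a powr t * (1 / R) + b powr t = 1 / R"
    using eq t by (auto simp: field_simps)
  have "hausdorff_measure t Fu \<le> ennreal K"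
    using hausdorff_measure_upper[OF t(1,3) eq K] .
  moreover have "hausdorff_measure t Fv \<le> ennreal (K * R)"
    using swap.hausdorff_measure_upper[OF t(1) _ eq', of "K * R"] K t by simp
  ultimately have fin_t: "hausdorff_measure t Fu < \<infinity>" "hausdorff_measure t Fv < \<infinity>"
    by (auto simp: le_less_trans[of _ "ennreal K"] le_less_trans[of _ "ennreal (K * R)"])
  have "hausdorff_dim Fu = ennreal t"
    using pos_t fin_t t by (intro hausdorff_dim_eqI) auto
  then have "s = t" using assms t by simp
  then show "0 < s" "s < 1"
    "0 < hausdorff_measure s Fu" "hausdorff_measure s Fu < \<infinity>"
    "0 < hausdorff_measure s Fv" "hausdorff_measure s Fv < \<infinity>"
    using t pos_t fin_t by auto
qed


lemma interval_measure_step: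
  assumes s: "0 < s"
  shows "hausdorff_measure s (Fu \<inter> {x..y}) \<le>
    (if x \<le> a then ennreal (a powr s) * hausdorff_measure s (Fu \<inter> {x / a..min 1 (y / a)}) else 0)
    + (if 1 - b \<le> y then ennreal (b powr s) *
        hausdorff_measure s (Fv \<inter> {max 0 ((x - (1 - b)) / b)..(y - (1 - b)) / b}) else 0)"
proof -
  interpret swap: two_vertex_IFS c gv b a gu Fv Fu by (rule swap)
  define A where "A = (if x \<le> a then (\<lambda>z. a * z) ` (Fu \<inter> {x / a..min 1 (y / a)}) else {})"
  define B where "B = (if 1 - b \<le> y then
    (\<lambda>z. b * z + (1 - b)) ` (Fv \<inter> {max 0 ((x - (1 - b)) / b)..(y - (1 - b)) / b}) else {})"
  have "Fu \<inter> {x..y} \<subseteq> A \<union> B"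
  proof
    fix z assume z: "z \<in> Fu \<inter> {x..y}"
    then have "z \<in> Fu" by simp
    then show "z \<in> A \<union> B"
    proof (cases rule: Fu_cases)
      case (1 w)
      have "x \<le> a * w" using z 1 by simp
      then have "x \<le> a" using left_bounds(2)[OF 1(1)] by linarith
      moreover have "w \<in> Fu \<inter> {x / a..min 1 (y / a)}"
        using 1 z bounds_u[of w] pos(1) by (simp add: field_simps)
      ultimately show ?thesis using 1(2) by (simp only: A_def if_True Un_iff image_iff) blast
    next
      case (2 w)
      have "b * w + (1 - b) \<le> y" using z 2 by simp
      then have "1 - b \<le> y" using right_bounds(1)[OF 2(1)] by linarith
      moreover have "w \<in> Fv \<inter> {max 0 ((x - (1 - b)) / b)..(y - (1 - b)) / b}"
        using 2 z swap.bounds_u[of w] pos(3) by (simp add: field_simps)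
      ultimately show ?thesis using 2(2) by (simp only: B_def if_True Un_iff image_iff) blast
    qed
  qed
  then have "hausdorff_measure s (Fu \<inter> {x..y}) \<le> hausdorff_measure s (A \<union> B)"
    by (rule hausdorff_measure_mono)
  also have "\<dots> \<le> hausdorff_measure s A + hausdorff_measure s B"
    by (rule hausdorff_measure_Un)
  finally show ?thesis
    unfolding A_def B_def if_distrib[of "hausdorff_measure s"] hausdorff_measure_empty
      hausdorff_measure_similarity[OF sim_left pos(1) s] hausdorff_measure_similarity[OF sim_right pos(3) s] .
qed

text \<open>
  Since \<open>a + gu = 1 - b\<close>, the assumption on \<open>(a + gu) (1 - a\<^sup>s) / (b a\<^sup>s)\<close> amounts to
  \<open>b \<le> 1 - a\<^sup>s\<close>.
\<close>
lemma interval_density: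
  assumes dim: "0 \<le> s" "hausdorff_dim Fu = ennreal s"
    and ratio: "hausdorff_measure s Fv / hausdorff_measure s Fu \<le> 1"
    and cond: "(a + gu) * (1 - a powr s) / (b * a powr s) \<ge> 1"
    and xy: "0 \<le> x" "x \<le> y" "y \<le> 1"
  shows "hausdorff_measure s (Fu \<inter> {x..y}) \<le> ennreal ((y - x) powr s) * hausdorff_measure s Fu"
proof -
  interpret swap: two_vertex_IFS c gv b a gu Fv Fu by (rule swap)
  note H = measure_positive_finite_at_dim[OF dim]
  define m where "m F x y = enn2real (hausdorff_measure s (F \<inter> {x..y}))" for F :: "real set" and x y
  define hu hv where "hu = enn2real (hausdorff_measure s Fu)" and "hv = enn2real (hausdorff_measure s Fv)"
  have hu: "hausdorff_measure s Fu = ennreal hu" "0 < hu"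
    using H(3,4) by (auto simp: hu_def enn2real_positive_iff)
  have hv: "hausdorff_measure s Fv = ennreal hv" "0 < hv"
    using H(5,6) by (auto simp: hv_def enn2real_positive_iff)
  have m_u: "hausdorff_measure s (Fu \<inter> {x..y}) = ennreal (m Fu x y)" "m Fu x y \<le> hu" for x y
  proof -
    have "hausdorff_measure s (Fu \<inter> {x..y}) \<le> ennreal hu"
      using hu(1) by (metis hausdorff_measure_mono inf_le1)
    then show "hausdorff_measure s (Fu \<inter> {x..y}) = ennreal (m Fu x y)" "m Fu x y \<le> hu"
      using enn2real_leI[OF less_imp_le[OF hu(2)]]
        ennreal_enn2real[OF le_less_trans[OF _ ennreal_less_top], symmetric]
      unfolding m_def by blast+
  qed
  have m_v: "hausdorff_measure s (Fv \<inter> {x..y}) = ennreal (m Fv x y)" "m Fv x y \<le> hv" for x y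
  proof -
    have "hausdorff_measure s (Fv \<inter> {x..y}) \<le> ennreal hv"
      using hv(1) by (metis hausdorff_measure_mono inf_le1)
    then show "hausdorff_measure s (Fv \<inter> {x..y}) = ennreal (m Fv x y)" "m Fv x y \<le> hv"
      using enn2real_leI[OF less_imp_le[OF hv(2)]]
        ennreal_enn2real[OF le_less_trans[OF _ ennreal_less_top], symmetric]
      unfolding m_def by blast+
  qed
  have m_nonneg: "0 \<le> m F x y" for F x y by (simp add: m_def)
  have "ennreal hu = ennreal (a powr s * hu + b powr s * hv)"
    using hausdorff_measure_u_eq[OF H(1)] hu hv by (simp add: ennreal_mult)
  then have eq_u: "hu = a powr s * hu + b powr s * hv"
    using hu hv by (subst (asm) ennreal_inj) auto
  have "ennreal hv = ennreal (c powr s * hv + b powr s * hu)"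
    using swap.hausdorff_measure_u_eq[OF H(1)] hu hv by (simp add: ennreal_mult)
  then have eq_v: "hv = c powr s * hv + b powr s * hu"
    using hu hv by (subst (asm) ennreal_inj) auto
  have step_u: "m Fu x y \<le> (if x \<le> a then a powr s * m Fu (x / a) (min 1 (y / a)) else 0)
        + (if 1 - b \<le> y then b powr s * m Fv (max 0 ((x - (1 - b)) / b)) ((y - (1 - b)) / b) else 0)" for x y
    using interval_measure_step[OF H(1), of x y] m_nonneg unfolding m_u m_v
    by (simp split: if_splits flip: ennreal_mult ennreal_plus)
  have step_v: "m Fv x y \<le> (if x \<le> c then c powr s * m Fv (x / c) (min 1 (y / c)) else 0)
        + (if 1 - b \<le> y then b powr s * m Fu (max 0 ((x - (1 - b)) / b)) ((y - (1 - b)) / b) else 0)" for x y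
    using swap.interval_measure_step[OF H(1), of x y] m_nonneg unfolding m_u m_v
    by (simp split: if_splits flip: ennreal_mult ennreal_plus)
  define R where "R = hv / hu"
  have "m Fu x y / hu \<le> (y - x) powr s"
  proof (rule density_bound[where a = a and b = b and c = c and R = R and V = "\<lambda>x y. m Fv x y / hu"])
    show "R \<le> 1"
      using ratio hu hv by (simp add: R_def divide_ennreal)
    show "a powr s + b powr s * R = 1" "c powr s * R + b powr s = R"
      using eq_u eq_v hu(2) by (auto simp: R_def field_simps)
    have "b * a powr s \<le> (a + gu) * (1 - a powr s)"
      using cond pos by (simp add: pos_le_divide_eq)
    also have "a + gu = 1 - b" using sum_u by simp
    finally show "b \<le> 1 - a powr s" by (simp add: algebra_simps)
    show "m Fu x y / hu \<le> (if x \<le> a then a powr s * (m Fu (x / a) (min 1 (y / a)) / hu) else 0)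
        + (if 1 - b \<le> y then b powr s * (m Fv (max 0 ((x - (1 - b)) / b)) ((y - (1 - b)) / b) / hu) else 0)" for x y
      using divide_right_mono[OF step_u[of x y], of hu] hu(2)
      by (simp add: add_divide_distrib split: if_splits)
    show "m Fv x y / hu \<le> (if x \<le> c then c powr s * (m Fv (x / c) (min 1 (y / c)) / hu) else 0)
        + (if 1 - b \<le> y then b powr s * (m Fu (max 0 ((x - (1 - b)) / b)) ((y - (1 - b)) / b) / hu) else 0)" for x y
      using divide_right_mono[OF step_v[of x y], of hu] hu(2)
      by (simp add: add_divide_distrib split: if_splits)
    show "m Fu x y / hu \<le> 1" "m Fv x y / hu \<le> R" for x y
      using m_u(2) m_v(2) hu(2) by (auto simp: R_def divide_right_mono)
  qed (use H(1,2) xy pos sum_u sum_v hu hv in \<open>auto simp: R_def\<close>)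
  then have "m Fu x y \<le> (y - x) powr s * hu"
    using hu(2) by (simp add: field_simps)
  then show ?thesis
    unfolding m_u hu using hu(2) by (subst ennreal_mult[symmetric]) (auto intro: ennreal_leI)
qed

text \<open>
  Every neighbourhood of a point of \<open>Fu\<close> contains a small similar copy of \<open>Fu\<close> or \<open>Fv\<close>. The
  induction enlarges the neighbourhood by passing to a preimage until it contains the whole set.
\<close>
lemma positive_measure_near_point:
  assumes s: "0 < s" and H: "0 < hausdorff_measure s Fu" "0 < hausdorff_measure s Fv"
    and "z \<in> Fu" "0 < e"
  shows "0 < hausdorff_measure s (Fu \<inter> {z - e..z + e})"
proof -
  interpret swap: two_vertex_IFS c gv b a gu Fv Fu by (rule swap)
  define q where "q = max a (max b c)"
  have q: "0 < q" "q < 1" "a \<le> q" "b \<le> q" "c \<le> q"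
    using pos less_one by (auto simp: q_def)
  have scale: "0 < hausdorff_measure s (F' \<inter> {k * z + d - e..k * z + d + e})"
    if "0 < hausdorff_measure s (F \<inter> {z - e / k..z + e / k})" "0 < k"
      "\<And>w. w \<in> F \<Longrightarrow> k * w + d \<in> F'" for F F' :: "real set" and k d z e :: real
  proof -
    have "dist (k * x + d) (k * y + d) = k * dist x y" for x y
    proof -
      have "k * x + d - (k * y + d) = k * (x - y)" by (simp add: algebra_simps)
      then show ?thesis unfolding dist_real_def using that(2) by (simp only: abs_mult abs_of_pos)
    qed
    then have "hausdorff_measure s ((\<lambda>w. k * w + d) ` (F \<inter> {z - e / k..z + e / k}))
        = ennreal (k powr s) * hausdorff_measure s (F \<inter> {z - e / k..z + e / k})"
      by (rule hausdorff_measure_similarity[OF _ that(2) s])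
    moreover have "(\<lambda>w. k * w + d) ` (F \<inter> {z - e / k..z + e / k}) \<subseteq> F' \<inter> {k * z + d - e..k * z + d + e}"
      using that(2,3) by (auto simp: field_simps)
    ultimately show ?thesis
      using that(1,2) hausdorff_measure_mono[of _ "F' \<inter> {k * z + d - e..k * z + d + e}" s]
      by (metis ennreal_zero_less_mult_iff ennreal_less_zero_iff less_le_trans powr_gt_zero less_irrefl)
  qed
  have smaller: "q ^ n < e / k" if "q ^ Suc n < e" "0 < k" "k \<le> q" for n e k
  proof -
    have "k * q ^ n \<le> q * q ^ n" using that q by simp
    then have "q ^ n * k < e" using that(1) by (simp add: mult.commute)
    then show ?thesis using that(2) by (simp add: pos_less_divide_eq)
  qed
  have "(\<forall>z\<in>Fu. \<forall>e>q ^ n. 0 < hausdorff_measure s (Fu \<inter> {z - e..z + e}))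
      \<and> (\<forall>z\<in>Fv. \<forall>e>q ^ n. 0 < hausdorff_measure s (Fv \<inter> {z - e..z + e}))" for n
  proof (induction n)
    case 0
    have "Fu \<inter> {z - e..z + e} = Fu" if "z \<in> Fu" "1 < e" for z e
      using that bounds_u by fastforce
    moreover have "Fv \<inter> {z - e..z + e} = Fv" if "z \<in> Fv" "1 < e" for z e
      using that swap.bounds_u by fastforce
    ultimately show ?case using H by simp
  next
    case (Suc n)
    have u: "0 < hausdorff_measure s (Fu \<inter> {z - e..z + e})" if "z \<in> Fu" "q ^ Suc n < e" for z e
      using that(1)
    proof (cases rule: Fu_cases)
      case (1 w)
      then show ?thesis
        using scale[where k = a and d = 0 and F = Fu and z = w and e = e] Suc
          smaller[OF that(2) pos(1)] q left_in_u pos(1) by auto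
    next
      case (2 w)
      then show ?thesis
        using scale[where k = b and d = "1 - b" and F = Fv and z = w and e = e] Suc
          smaller[OF that(2) pos(3)] q right_in_u pos(3) by auto
    qed
    have v: "0 < hausdorff_measure s (Fv \<inter> {z - e..z + e})" if "z \<in> Fv" "q ^ Suc n < e" for z e
      using that(1)
    proof (cases rule: swap.Fu_cases)
      case (1 w)
      then show ?thesis
        using scale[where k = c and d = 0 and F = Fv and z = w and e = e] Suc
          smaller[OF that(2) pos(4)] q swap.left_in_u pos(4) by auto
    next
      case (2 w)
      then show ?thesis
        using scale[where k = b and d = "1 - b" and F = Fu and z = w and e = e] Suc
          smaller[OF that(2) pos(3)] q swap.right_in_u pos(3) by auto
    qed
    show ?case using u v by blast
  qed
  moreover obtain n where "q ^ n < e" using real_arch_pow_inv q \<open>0 < e\<close> by blast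
  ultimately show ?thesis using \<open>z \<in> Fu\<close> by blast
qed

text \<open>
  Both sides of the last equation have hull \<open>[\<alpha>, \<alpha> + r]\<close>, and by the density bound the
  copy \<open>S ` Fu\<close> exhausts the measure available in this interval. A point of \<open>Fu\<close> in the
  interval outside the copy would have a neighbourhood of positive measure disjoint from it.
\<close>
lemma similar_copy_is_interval_part:
  assumes s: "0 < s" and H: "0 < hausdorff_measure s Fu" "hausdorff_measure s Fu < \<infinity>"
      "0 < hausdorff_measure s Fv"
    and dens: "\<And>x y. 0 \<le> x \<Longrightarrow> x \<le> y \<Longrightarrow> y \<le> 1 \<Longrightarrow>
      hausdorff_measure s (Fu \<inter> {x..y}) \<le> ennreal ((y - x) powr s) * hausdorff_measure s Fu"
    and S: "\<And>x y. dist (S x) (S y) = r * dist x y" "0 < r" and sub: "S ` Fu \<subseteq> Fu"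
  obtains \<alpha> where "\<alpha> \<in> Fu" "\<alpha> + r \<in> Fu" "S ` Fu = Fu \<inter> {\<alpha>..\<alpha> + r}"
proof -
  define \<alpha> where "\<alpha> = min (S 0) (S 1)"
  have S01: "\<bar>S 0 - S 1\<bar> = r" using S(1)[of 0 1] by (simp add: dist_real_def)
  then have ends: "\<alpha> \<in> S ` Fu" "\<alpha> + r \<in> S ` Fu"
    using zero_in_u one_in_u by (auto simp: \<alpha>_def min_def abs_if split: if_splits)
  have img: "S ` Fu \<subseteq> {\<alpha>..\<alpha> + r}"
  proof
    fix z assume "z \<in> S ` Fu"
    then obtain x where x: "x \<in> Fu" "z = S x" by blast
    have "\<bar>z - S 0\<bar> = r * x" "\<bar>z - S 1\<bar> = r - r * x"
      using S(1)[of x 0] S(1)[of x 1] bounds_u[OF x(1)] x(2)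
      by (auto simp: dist_real_def right_diff_distrib)
    then show "z \<in> {\<alpha>..\<alpha> + r}"
      using S01 by (auto simp: \<alpha>_def min_def)
  qed
  have "Fu \<inter> {\<alpha>..\<alpha> + r} \<subseteq> S ` Fu"
  proof (rule ccontr)
    assume "\<not> ?thesis"
    then obtain z where "z \<in> Fu \<inter> {\<alpha>..\<alpha> + r}" and z4: "z \<notin> S ` Fu" by blast
    then have z: "z \<in> Fu" "\<alpha> \<le> z" "z \<le> \<alpha> + r" by auto
    have "r-lipschitz_on Fu S"
      using S by (intro lipschitz_onI) auto
    then have "continuous_on Fu S"
      by (rule lipschitz_on_continuous_on)
    then have "closed (S ` Fu)"
      using compact_continuous_image compact_u compact_imp_closed by blast
    then obtain e where e: "0 < e" "\<And>w. w \<in> S ` Fu \<Longrightarrow> e \<le> dist z w"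
      using z4 by (metis separate_point_closed)
    define P where "P = Fu \<inter> {z - e / 2..z + e / 2}"
    have near: "dist w z \<le> e / 2" if "w \<in> P" for w
      using that by (auto simp: P_def dist_real_def abs_if)
    have "e \<le> z - \<alpha>" "e \<le> \<alpha> + r - z"
      using e(2)[OF ends(1)] e(2)[OF ends(2)] z by (auto simp: dist_real_def)
    then have "S ` Fu \<union> P \<subseteq> Fu \<inter> {\<alpha>..\<alpha> + r}"
      using img sub e(1) by (auto simp: P_def)
    then have "hausdorff_measure s (S ` Fu \<union> P) \<le> hausdorff_measure s (Fu \<inter> {\<alpha>..\<alpha> + r})"
      by (rule hausdorff_measure_mono)
    also have "\<dots> \<le> ennreal (r powr s) * hausdorff_measure s Fu"
      using dens[of \<alpha> "\<alpha> + r"] ends sub bounds_u S(2) by auto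
    also have "hausdorff_measure s (S ` Fu \<union> P) = hausdorff_measure s (S ` Fu) + hausdorff_measure s P"
    proof (rule hausdorff_measure_Un_separated)
      show "e / 2 \<le> dist x y" if "x \<in> S ` Fu" "y \<in> P" for x y
        using e(2)[OF that(1)] near[OF that(2)] dist_triangle[of z x y] by (simp add: dist_commute)
    qed (use e(1) s in auto)
    also have "hausdorff_measure s (S ` Fu) = ennreal (r powr s) * hausdorff_measure s Fu"
      by (rule hausdorff_measure_similarity[OF S s])
    finally have "ennreal (r powr s) * hausdorff_measure s Fu + hausdorff_measure s P
        \<le> ennreal (r powr s) * hausdorff_measure s Fu" .
    moreover have "0 < hausdorff_measure s P"
      unfolding P_def using s H(1,3) z(1) e(1) by (intro positive_measure_near_point) auto
    moreover have "ennreal (r powr s) * hausdorff_measure s Fu < \<infinity>"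
      using H(2) by (simp add: ennreal_mult_less_top)
    ultimately show False
      using ennreal_add_left_cancel_less[of "ennreal (r powr s) * hausdorff_measure s Fu" 0]
      by (auto simp: not_le)
  qed
  then show thesis
    using that[of \<alpha>] ends sub img by blast
qed

end

section \<open>Gap lengths\<close>

definition gap :: "real set \<Rightarrow> real \<Rightarrow> real \<Rightarrow> bool" where
  "gap F x y \<longleftrightarrow> x \<in> F \<and> y \<in> F \<and> x < y \<and> (\<forall>z\<in>F. \<not> (x < z \<and> z < y))"

lemma gap_interval_part:
  "gap (F \<inter> {\<alpha>..\<beta>}) x y \<longleftrightarrow> gap F x y \<and> \<alpha> \<le> x \<and> y \<le> \<beta>"
  unfolding gap_def by fastforce

lemma gap_similarity_image:
  fixes S :: "real \<Rightarrow> real"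
  assumes S: "\<And>x y. dist (S x) (S y) = r * dist x y" and r: "0 < r" and "gap F x y"
  obtains u v where "gap (S ` F) u v" "v - u = r * (y - x)"
proof -
  have xy: "x \<in> F" "y \<in> F" "x < y" "\<And>z. z \<in> F \<Longrightarrow> \<not> (x < z \<and> z < y)"
    using assms(3) by (auto simp: gap_def)
  have S_abs: "\<bar>S p - S q\<bar> = r * \<bar>p - q\<bar>" for p q
    using S by (simp add: dist_real_def)
  define u v where "u = min (S x) (S y)" and "v = max (S x) (S y)"
  have len: "v - u = r * (y - x)"
    using S_abs[of x y] xy(3) by (auto simp: u_def v_def min_def max_def)
  have "\<not> (u < S z \<and> S z < v)" if "z \<in> F" for z
  proof
    assume *: "u < S z \<and> S z < v"
    then have "\<bar>S z - S x\<bar> + \<bar>S z - S y\<bar> = v - u" "S z \<noteq> S x" "S z \<noteq> S y"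
      by (auto simp: u_def v_def min_def max_def split: if_splits)
    then have "r * (\<bar>z - x\<bar> + \<bar>z - y\<bar>) = r * (y - x)" "z \<noteq> x" "z \<noteq> y"
      using S_abs len by (auto simp: distrib_left)
    then have "\<bar>z - x\<bar> + \<bar>z - y\<bar> = y - x" using r by simp
    with \<open>z \<noteq> x\<close> \<open>z \<noteq> y\<close> have "x < z \<and> z < y" by linarith
    then show False using xy(4)[OF that] by simp
  qed
  moreover have "u < v" using len xy(3) r by (smt (verit) mult_pos_pos)
  moreover have "u \<in> S ` F" "v \<in> S ` F"
    using xy(1,2) by (auto simp: u_def v_def min_def max_def)
  ultimately have "gap (S ` F) u v" by (auto simp: gap_def)
  then show thesis using len that by blast
qed

lemma gap_similarity_preimage:
  fixes S :: "real \<Rightarrow> real"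
  assumes S: "\<And>x y. dist (S x) (S y) = r * dist x y" and r: "0 < r" and "gap (S ` F) u v"
  obtains x y where "gap F x y" "v - u = r * (y - x)"
proof -
  have S_abs: "\<bar>S p - S q\<bar> = r * \<bar>p - q\<bar>" for p q
    using S by (simp add: dist_real_def)
  obtain p q where pq: "p \<in> F" "q \<in> F" "u = S p" "v = S q"
    using assms(3) by (auto simp: gap_def)
  have uv: "u < v" "\<And>z. z \<in> F \<Longrightarrow> \<not> (u < S z \<and> S z < v)"
    using assms(3) by (auto simp: gap_def)
  define x y where "x = min p q" and "y = max p q"
  have len: "v - u = r * (y - x)"
    using S_abs[of p q] uv(1) pq by (auto simp: x_def y_def min_def max_def)
  have "\<not> (x < z \<and> z < y)" if "z \<in> F" for z
  proof
    assume *: "x < z \<and> z < y"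
    then have "\<bar>z - p\<bar> + \<bar>z - q\<bar> = y - x" "z \<noteq> p" "z \<noteq> q"
      by (auto simp: x_def y_def min_def max_def split: if_splits)
    then have "\<bar>S z - u\<bar> + \<bar>S z - v\<bar> = v - u" "0 < \<bar>S z - u\<bar>" "0 < \<bar>S z - v\<bar>"
      using r unfolding pq S_abs len[unfolded pq] by (simp_all flip: distrib_left)
    then have "u < S z \<and> S z < v" by linarith
    then show False using uv(2)[OF that] by simp
  qed
  moreover have "x < y" using len uv(1) r by (smt (verit) mult_less_0_iff zero_less_mult_iff)
  moreover have "x \<in> F" "y \<in> F"
    using pq(1,2) by (auto simp: x_def y_def min_def max_def)
  ultimately have "gap F x y" by (auto simp: gap_def)
  then show thesis using len that by blast
qed

text \<open>
  The contraction ratios of the closed walks at \<open>u\<close>, and of the walks from \<open>u\<close> to \<open>v\<close>. The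
  loop at \<open>v\<close> can occur in a closed walk only together with a visit to \<open>v\<close>, whence the
  condition relating \<open>j\<close> and \<open>k\<close>. Exchanging \<open>a\<close> and \<open>c\<close> gives the walks
  starting at \<open>v\<close>.
\<close>
definition loop_weights :: "real \<Rightarrow> real \<Rightarrow> real \<Rightarrow> real set" where
  "loop_weights a b c = {w. \<exists>i j k. w = a ^ i * b ^ (2 * j) * c ^ k \<and> (0 < k \<longrightarrow> 0 < j)}"

definition crossing_weights :: "real \<Rightarrow> real \<Rightarrow> real \<Rightarrow> real set" where
  "crossing_weights a b c = {w. \<exists>i j k. w = a ^ i * b ^ (2 * j + 1) * c ^ k}"

definition gap_lengths :: "real \<Rightarrow> real \<Rightarrow> real \<Rightarrow> real \<Rightarrow> real \<Rightarrow> real set" where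
  "gap_lengths gu gv a b c =
     {d. \<exists>w. d = gu * w \<and> w \<in> loop_weights a b c \<or> d = gv * w \<and> w \<in> crossing_weights a b c}"

lemma one_loop_weight: "1 \<in> loop_weights a b c"
  unfolding loop_weights_def by (auto intro!: exI[of _ "0::nat"])

lemma weights_step:
  shows "w \<in> loop_weights a b c \<Longrightarrow> a * w \<in> loop_weights a b c"
    and "w \<in> crossing_weights a b c \<Longrightarrow> a * w \<in> crossing_weights a b c"
    and "w \<in> loop_weights c b a \<Longrightarrow> b * w \<in> crossing_weights a b c"
    and "w \<in> crossing_weights c b a \<Longrightarrow> b * w \<in> loop_weights a b c"
proof -
  assume "w \<in> loop_weights a b c"
  then obtain i j k where "w = a ^ i * b ^ (2 * j) * c ^ k" "0 < k \<longrightarrow> 0 < j"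
    by (auto simp: loop_weights_def)
  then show "a * w \<in> loop_weights a b c"
    unfolding loop_weights_def by (intro CollectI exI[of _ "Suc i"] exI[of _ j] exI[of _ k]) simp
next
  assume "w \<in> crossing_weights a b c"
  then obtain i j k where "w = a ^ i * b ^ (2 * j + 1) * c ^ k"
    by (auto simp: crossing_weights_def)
  then show "a * w \<in> crossing_weights a b c"
    unfolding crossing_weights_def by (intro CollectI exI[of _ "Suc i"] exI[of _ j] exI[of _ k]) simp
next
  assume "w \<in> loop_weights c b a"
  then obtain i j k where "w = c ^ i * b ^ (2 * j) * a ^ k"
    by (auto simp: loop_weights_def)
  then show "b * w \<in> crossing_weights a b c"
    unfolding crossing_weights_def by (intro CollectI exI[of _ k] exI[of _ j] exI[of _ i]) simp
next
  assume "w \<in> crossing_weights c b a"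
  then obtain i j k where "w = c ^ i * b ^ (2 * j + 1) * a ^ k"
    by (auto simp: crossing_weights_def)
  then show "b * w \<in> loop_weights a b c"
    unfolding loop_weights_def by (intro CollectI exI[of _ k] exI[of _ "Suc j"] exI[of _ i]) simp
qed

lemma gap_lengths_step:
  shows "gu \<in> gap_lengths gu gv a b c"
    and "d \<in> gap_lengths gu gv a b c \<Longrightarrow> a * d \<in> gap_lengths gu gv a b c"
    and "d \<in> gap_lengths gv gu c b a \<Longrightarrow> b * d \<in> gap_lengths gu gv a b c"
proof -
  show "gu \<in> gap_lengths gu gv a b c"
    unfolding gap_lengths_def using one_loop_weight by (auto intro!: exI[of _ 1])
  show "a * d \<in> gap_lengths gu gv a b c" if "d \<in> gap_lengths gu gv a b c"
    using that unfolding gap_lengths_def mem_Collect_eq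
    by (metis mult.left_commute weights_step(1,2))
  show "b * d \<in> gap_lengths gu gv a b c" if "d \<in> gap_lengths gv gu c b a"
    using that unfolding gap_lengths_def mem_Collect_eq
    by (metis mult.left_commute weights_step(3,4))
qed

lemma mult_rat_independent_monomials:
  assumes ind: "mult_rat_independent [gu, gv, a, b, c]"
    and eq: "gu ^ m0 * gv ^ m1 * a ^ m2 * b ^ m3 * c ^ m4 = gu ^ n0 * gv ^ n1 * a ^ n2 * b ^ n3 * c ^ n4"
  shows "m0 = n0 \<and> m1 = n1 \<and> m2 = n2 \<and> m3 = n3 \<and> m4 = n4"
proof -
  have pos: "0 < gu" "0 < gv" "0 < a" "0 < b" "0 < c"
    using ind by (auto simp: mult_rat_independent_def)
  define m :: "nat \<Rightarrow> int" where
    "m i = [int m0 - int n0, int m1 - int n1, int m2 - int n2, int m3 - int n3, int m4 - int n4] ! i" for i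
  have "(\<Prod>i<length [gu, gv, a, b, c]. ([gu, gv, a, b, c] ! i) powi m i)
      = (gu ^ m0 * gv ^ m1 * a ^ m2 * b ^ m3 * c ^ m4) / (gu ^ n0 * gv ^ n1 * a ^ n2 * b ^ n3 * c ^ n4)"
    using pos by (simp add: m_def power_int_diff lessThan_Suc ac_simps)
  also have "\<dots> = 1"
    using pos unfolding eq by simp
  finally have "\<forall>i<length [gu, gv, a, b, c]. m i = 0"
    using ind unfolding mult_rat_independent_def by blast
  then have "m 0 = 0" "m 1 = 0" "m 2 = 0" "m 3 = 0" "m 4 = 0" by auto
  then show ?thesis by (simp add: m_def)
qed

context two_vertex_IFS
begin

lemma a_in_u: "a \<in> Fu" and right_end_in_u: "1 - b \<in> Fu"
proof -
  interpret swap: two_vertex_IFS c gv b a gu Fv Fu by (rule swap)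
  show "a \<in> Fu" using left_in_u[OF one_in_u] by simp
  show "1 - b \<in> Fu" using right_in_u[OF swap.zero_in_u] by simp
qed

lemma no_point_in_central_gap: "z \<in> Fu \<Longrightarrow> z \<le> a \<or> 1 - b \<le> z"
  using Fu_left(2) by force

lemma central_gap: "gap Fu a (1 - b)"
  using a_in_u right_end_in_u less_one no_point_in_central_gap by (fastforce simp: gap_def)

lemma gap_scale_left:
  assumes "gap Fu x y"
  shows "gap Fu (a * x) (a * y)"
  unfolding gap_def
proof (intro conjI ballI notI)
  have xy: "x \<in> Fu" "y \<in> Fu" "x < y" "\<And>z. z \<in> Fu \<Longrightarrow> \<not> (x < z \<and> z < y)"
    using assms by (auto simp: gap_def)
  show "a * x \<in> Fu" "a * y \<in> Fu" "a * x < a * y"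
    using xy left_in_u pos(1) by auto
  fix z assume z: "z \<in> Fu" "a * x < z \<and> z < a * y"
  then have "z < 1 - b" using left_bounds(2)[OF xy(2)] less_one by linarith
  then have "z / a \<in> Fu" using Fu_left(1) z(1) by blast
  then show False using xy(4)[of "z / a"] z(2) pos(1) by (simp add: field_simps)
qed

lemma gap_scale_right:
  assumes "gap Fv x y"
  shows "gap Fu (b * x + (1 - b)) (b * y + (1 - b))"
  unfolding gap_def
proof (intro conjI ballI notI)
  have xy: "x \<in> Fv" "y \<in> Fv" "x < y" "\<And>z. z \<in> Fv \<Longrightarrow> \<not> (x < z \<and> z < y)"
    using assms by (auto simp: gap_def)
  show "b * x + (1 - b) \<in> Fu" "b * y + (1 - b) \<in> Fu" "b * x + (1 - b) < b * y + (1 - b)"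
    using xy right_in_u pos(3) by auto
  fix z assume z: "z \<in> Fu" "b * x + (1 - b) < z \<and> z < b * y + (1 - b)"
  then have "a < z" using right_bounds(1)[OF xy(1)] less_one by linarith
  then have "(z - (1 - b)) / b \<in> Fv" using Fu_right(1) z(1) by blast
  moreover have "x < (z - (1 - b)) / b" "(z - (1 - b)) / b < y"
    using z(2) pos(3) by (auto simp: pos_less_divide_eq pos_divide_less_eq mult.commute)
  ultimately show False using xy(4) by blast
qed

lemma gap_cases:
  assumes "gap Fu x y"
  obtains "y - x = gu"
  | x' y' where "gap Fu x' y'" "y - x = a * (y' - x')"
  | x' y' where "gap Fv x' y'" "y - x = b * (y' - x')"
proof -
  have xy: "x \<in> Fu" "y \<in> Fu" "x < y" "\<And>z. z \<in> Fu \<Longrightarrow> \<not> (x < z \<and> z < y)"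
    using assms by (auto simp: gap_def)
  consider "y < 1 - b" | "a < x" | "x \<le> a" "1 - b \<le> y" by linarith
  then show thesis
  proof cases
    case 1
    have "x / a \<in> Fu" "y / a \<in> Fu" using Fu_left(1) xy 1 by auto
    moreover have "\<not> (x / a < z \<and> z < y / a)" if "z \<in> Fu" for z
      using xy(4)[OF left_in_u[OF that]] pos(1) by (simp add: field_simps)
    ultimately have "gap Fu (x / a) (y / a)"
      using xy(3) pos(1) by (auto simp: gap_def divide_strict_right_mono)
    then show ?thesis using pos(1) by (intro that(2)) (auto simp: field_simps)
  next
    case 2
    define x' y' where "x' = (x - (1 - b)) / b" and "y' = (y - (1 - b)) / b"
    have ends: "x' \<in> Fv" "y' \<in> Fv" using Fu_right(1) xy 2 by (auto simp: x'_def y'_def)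
    have recover: "b * x' + (1 - b) = x" "b * y' + (1 - b) = y"
      using pos(3) by (simp_all add: x'_def y'_def)
    have b_less: "b * p + (1 - b) < b * q + (1 - b) \<longleftrightarrow> p < q" for p q
      using pos(3) by simp
    have "x' < y'" using xy(3) b_less recover by metis
    moreover have "\<not> (x' < z \<and> z < y')" if "z \<in> Fv" for z
      using xy(4)[OF right_in_u[OF that]] b_less[of x' z] b_less[of z y'] unfolding recover by blast
    ultimately have "gap Fv x' y'"
      using ends by (auto simp: gap_def)
    moreover have "y - x = b * (y' - x')"
      using recover by (simp add: right_diff_distrib)
    ultimately show ?thesis by (rule that(3))
  next
    case 3
    then have "x = a" "y = 1 - b"
      using xy(4)[OF a_in_u] xy(4)[OF right_end_in_u] less_one by linarith+
    then show ?thesis using sum_u by (intro that(1)) simp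
  qed
qed

text \<open>
  A gap is the central one or the image of a longer gap, longer by a factor of at least
  \<open>1 / max a b c\<close>; as gaps have length at most \<open>1\<close>, the descent ends.
\<close>
lemma gap_length:
  assumes "gap Fu x y"
  shows "y - x \<in> gap_lengths gu gv a b c"
proof -
  interpret swap: two_vertex_IFS c gv b a gu Fv Fu by (rule swap)
  define q where "q = max a (max b c)"
  have q: "0 < q" "q < 1" "a \<le> q" "b \<le> q" "c \<le> q"
    using pos less_one by (auto simp: q_def)
  have larger: "q ^ n < d" if "q ^ Suc n < k * d" "0 < k" "k \<le> q" for n k d
  proof -
    have "k * q ^ n \<le> q * q ^ n" using that q by simp
    then have "k * q ^ n < k * d" using that(1) by simp
    then show ?thesis using that(2) by simp
  qed
  have "(\<forall>x y. gap Fu x y \<longrightarrow> q ^ n < y - x \<longrightarrow> y - x \<in> gap_lengths gu gv a b c)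
      \<and> (\<forall>x y. gap Fv x y \<longrightarrow> q ^ n < y - x \<longrightarrow> y - x \<in> gap_lengths gv gu c b a)" for n
  proof (induction n)
    case 0
    have "y - x \<le> 1" if "gap Fu x y" for x y
      using that bounds_u[of x] bounds_u[of y] by (auto simp: gap_def)
    moreover have "y - x \<le> 1" if "gap Fv x y" for x y
      using that swap.bounds_u[of x] swap.bounds_u[of y] by (auto simp: gap_def)
    ultimately show ?case by force
  next
    case (Suc n)
    have "y - x \<in> gap_lengths gu gv a b c" if "gap Fu x y" "q ^ Suc n < y - x" for x y
      using that(1)
    proof (cases rule: gap_cases)
      case 1
      then show ?thesis by (simp add: gap_lengths_step)
    next
      case (2 x' y')
      then show ?thesis
        using Suc larger[of n a "y' - x'"] that(2) q pos(1) by (metis gap_lengths_step(2))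
    next
      case (3 x' y')
      then show ?thesis
        using Suc larger[of n b "y' - x'"] that(2) q pos(3) by (metis gap_lengths_step(3))
    qed
    moreover have "y - x \<in> gap_lengths gv gu c b a" if "gap Fv x y" "q ^ Suc n < y - x" for x y
      using that(1)
    proof (cases rule: swap.gap_cases)
      case 1
      then show ?thesis by (simp add: gap_lengths_step)
    next
      case (2 x' y')
      then show ?thesis
        using Suc larger[of n c "y' - x'"] that(2) q pos(4) by (metis gap_lengths_step(2))
    next
      case (3 x' y')
      then show ?thesis
        using Suc larger[of n b "y' - x'"] that(2) q pos(3) by (metis gap_lengths_step(3))
    qed
    ultimately show ?case by blast
  qed
  moreover obtain n where "q ^ n < y - x"
    using real_arch_pow_inv[of "y - x" q] q assms by (auto simp: gap_def)
  ultimately show ?thesis using assms by blast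
qed

lemma gap_scale_left_power: "gap Fu x y \<Longrightarrow> gap Fu (a ^ n * x) (a ^ n * y)"
proof (induction n)
  case (Suc n)
  then show ?case using gap_scale_left[of "a ^ n * x" "a ^ n * y"] by (simp add: mult.assoc)
qed simp

text \<open>
  The comparison of gap lengths in both directions: \<open>r\<close> times a gap length of \<open>Fu\<close> is
  again one, and a gap inside the interval is \<open>r\<close> times a gap length of \<open>Fu\<close>. In each case
  independence is used by comparing exponents of monomials in the five parameters.
\<close>
lemma similar_interval_part_avoids_right_piece:
  assumes ind: "mult_rat_independent [gu, gv, a, b, c]"
    and S: "\<And>x y. dist (S x) (S y) = r * dist x y" and r: "0 < r" "r < 1"
    and part: "\<alpha> \<in> Fu" "\<alpha> + r \<in> Fu" "S ` Fu = Fu \<inter> {\<alpha>..\<alpha> + r}"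
  shows "1 - b \<notin> S ` Fu"
proof
  interpret swap: two_vertex_IFS c gv b a gu Fv Fu by (rule swap)
  assume "1 - b \<in> S ` Fu"
  then have in_part: "\<alpha> \<le> 1 - b" "1 - b \<le> \<alpha> + r" using part(3) by auto
  note exponents = mult_rat_independent_monomials[OF ind]
  have gap_shrink: "r * (y - x) \<in> gap_lengths gu gv a b c" if g: "gap Fu x y" for x y
  proof -
    obtain u v where "gap (S ` Fu) u v" "v - u = r * (y - x)"
      using gap_similarity_image[OF S r(1) g] by blast
    then show ?thesis
      unfolding part(3) gap_interval_part using gap_length by metis
  qed
  have gap_enlarge: "\<exists>d\<in>gap_lengths gu gv a b c. y - x = r * d"
    if "gap Fu x y" "\<alpha> \<le> x" "y \<le> \<alpha> + r" for x y
  proof -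
    have "gap (S ` Fu) x y"
      unfolding part(3) gap_interval_part using that by blast
    then obtain x' y' where "gap Fu x' y'" "y - x = r * (y' - x')"
      using gap_similarity_preimage[OF S r(1)] by blast
    then show ?thesis using gap_length by blast
  qed
  have lengths_cases: "(\<exists>i j k. d = gu * (a ^ i * b ^ (2 * j) * c ^ k) \<and> (0 < k \<longrightarrow> 0 < j))
      \<or> (\<exists>i j k. d = gv * (a ^ i * b ^ (2 * j + 1) * c ^ k))"
    if "d \<in> gap_lengths gu gv a b c" for d
    using that unfolding gap_lengths_def loop_weights_def crossing_weights_def by blast
  have "1 - b - a = gu" using sum_u by simp
  then have short_u: "r * gu \<in> gap_lengths gu gv a b c"
    using gap_shrink[OF central_gap] by simp
  have "b * (1 - b) + (1 - b) - (b * c + (1 - b)) = b * (1 - b - c)" by (simp add: right_diff_distrib)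
  also have "1 - b - c = gv" using sum_v by simp
  finally have short_v: "r * (b * gv) \<in> gap_lengths gu gv a b c"
    using gap_shrink[OF gap_scale_right[OF swap.central_gap]] by metis
  have "\<exists>i j k. r = a ^ i * b ^ (2 * j) * c ^ k \<and> (0 < k \<longrightarrow> 0 < j)"
    using lengths_cases[OF short_u]
  proof (elim disjE exE)
    fix i j k assume "r * gu = gu * (a ^ i * b ^ (2 * j) * c ^ k) \<and> (0 < k \<longrightarrow> 0 < j)"
    then have "r = a ^ i * b ^ (2 * j) * c ^ k \<and> (0 < k \<longrightarrow> 0 < j)"
      using pos(2) mult_left_cancel[of gu r] by (metis less_irrefl mult.commute)
    then show ?thesis by blast
  next
    fix i j k assume cross: "r * gu = gv * (a ^ i * b ^ (2 * j + 1) * c ^ k)"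
    \<comment> \<open>\<open>gu\<close> times the gap length \<open>r b gv\<close> would be a monomial without \<open>gu\<close>\<close>
    have "(r * gu) * (b * gv) = gu * (r * (b * gv))" by (simp add: algebra_simps)
    then have prod: "gv ^ 2 * a ^ i * b ^ (2 * j + 2) * c ^ k = gu * (r * (b * gv))"
      unfolding cross by (simp add: power2_eq_square algebra_simps)
    have False
      using lengths_cases[OF short_v]
    proof (elim disjE exE)
      fix i' j' k' assume "r * (b * gv) = gu * (a ^ i' * b ^ (2 * j') * c ^ k') \<and> (0 < k' \<longrightarrow> 0 < j')"
      then have eq: "r * (b * gv) = gu * (a ^ i' * b ^ (2 * j') * c ^ k')" ..
      have "gu ^ 0 * gv ^ 2 * a ^ i * b ^ (2 * j + 2) * c ^ k
          = gu ^ 2 * gv ^ 0 * a ^ i' * b ^ (2 * j') * c ^ k'"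
        using prod[unfolded eq]
        by (simp only: ac_simps power2_eq_square power_0 power_one_right mult_1_left mult_1_right)
      from exponents[OF this] show False by simp
    next
      fix i' j' k' assume eq: "r * (b * gv) = gv * (a ^ i' * b ^ (2 * j' + 1) * c ^ k')"
      have "gu ^ 0 * gv ^ 2 * a ^ i * b ^ (2 * j + 2) * c ^ k
          = gu ^ 1 * gv ^ 1 * a ^ i' * b ^ (2 * j' + 1) * c ^ k'"
        using prod[unfolded eq]
        by (simp only: ac_simps power_0 power_one_right mult_1_left mult_1_right)
      from exponents[OF this] show False by simp
    qed
    then show ?thesis ..
  qed
  then obtain i j k where r_eq: "r = a ^ i * b ^ (2 * j) * c ^ k" and kj: "0 < k \<longrightarrow> 0 < j" by blast
  \<comment> \<open>a closed walk at \<open>u\<close> using neither the loop at \<open>u\<close> nor an edge to \<open>v\<close> is empty\<close>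
  have trivial: False if "i = 0" "j = 0"
  proof -
    have "k = 0" using kj that by simp
    then have "r = 1" using r_eq that by simp
    then show False using r(2) by simp
  qed
  have "\<not> \<alpha> < 1 - b"
  proof
    assume "\<alpha> < 1 - b"
    then have "\<alpha> \<le> a" using Fu_left(2) part(1) by blast
    then obtain d where d: "d \<in> gap_lengths gu gv a b c" "1 - b - a = r * d"
      using gap_enlarge[OF central_gap _ in_part(2)] by blast
    from lengths_cases[OF d(1)] show False
    proof (elim disjE exE)
      fix i' j' k' assume "d = gu * (a ^ i' * b ^ (2 * j') * c ^ k') \<and> (0 < k' \<longrightarrow> 0 < j')"
      then have d_eq: "d = gu * (a ^ i' * b ^ (2 * j') * c ^ k')" ..
      have "gu = a ^ i * b ^ (2 * j) * c ^ k * (gu * (a ^ i' * b ^ (2 * j') * c ^ k'))"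
        using d(2) unfolding \<open>1 - b - a = gu\<close> r_eq d_eq .
      then have "gu ^ 1 * gv ^ 0 * a ^ 0 * b ^ 0 * c ^ 0
          = gu ^ 1 * gv ^ 0 * a ^ (i + i') * b ^ (2 * j + 2 * j') * c ^ (k + k')"
        by (simp only: power_add ac_simps power_0 power_one_right mult_1_left mult_1_right)
      from exponents[OF this] show False by (intro trivial) auto
    next
      fix i' j' k' assume d_eq: "d = gv * (a ^ i' * b ^ (2 * j' + 1) * c ^ k')"
      have "gu = a ^ i * b ^ (2 * j) * c ^ k * (gv * (a ^ i' * b ^ (2 * j' + 1) * c ^ k'))"
        using d(2) unfolding \<open>1 - b - a = gu\<close> r_eq d_eq .
      then have "gu ^ 1 * gv ^ 0 * a ^ 0 * b ^ 0 * c ^ 0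
          = gu ^ 0 * gv ^ 1 * a ^ (i + i') * b ^ (2 * j + (2 * j' + 1)) * c ^ (k + k')"
        by (simp only: power_add ac_simps power_0 power_one_right mult_1_left mult_1_right)
      from exponents[OF this] show False by simp
    qed
  qed
  then have \<alpha>: "\<alpha> = 1 - b" using in_part(1) by simp
  have "a < \<alpha> + r" using \<alpha> less_one r by simp
  then have end_v: "r / b \<in> Fv"
    using Fu_right(1)[OF part(2)] \<alpha> by simp
  \<comment> \<open>the gaps of \<open>Fv\<close> between \<open>c\<^sup>m\<^sup>+\<^sup>1\<close> and \<open>c\<^sup>m (1 - b)\<close> accumulate at \<open>0\<close>\<close>
  obtain m where m: "c ^ m * c < r / b"
  proof -
    obtain n where n: "c ^ n < r / b"
      using real_arch_pow_inv[of "r / b" c] less_one r pos(3) by auto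
    have "c ^ n * c \<le> c ^ n"
      using less_one pos(4) by (simp add: mult_left_le)
    then show thesis using n that by (meson le_less_trans)
  qed
  have gap_v: "gap Fv (c ^ m * c) (c ^ m * (1 - b))"
    by (rule swap.gap_scale_left_power[OF swap.central_gap])
  then have "c ^ m * (1 - b) \<le> r / b"
    using end_v m by (auto simp: gap_def not_less)
  then have "b * (c ^ m * (1 - b)) \<le> r"
    using pos(3) by (simp add: pos_le_divide_eq mult.commute)
  then have "b * (c ^ m * (1 - b)) + (1 - b) \<le> \<alpha> + r"
    using \<alpha> by simp
  moreover have "\<alpha> \<le> b * (c ^ m * c) + (1 - b)"
    using \<alpha> pos by simp
  ultimately obtain d where d: "d \<in> gap_lengths gu gv a b c"
      "b * (c ^ m * (1 - b)) + (1 - b) - (b * (c ^ m * c) + (1 - b)) = r * d"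
    using gap_enlarge[OF gap_scale_right[OF gap_v]] by blast
  have "b * (c ^ m * (1 - b)) + (1 - b) - (b * (c ^ m * c) + (1 - b)) = b * c ^ m * (1 - b - c)"
    by (simp add: algebra_simps)
  also have "1 - b - c = gv" using sum_v by simp
  finally have len: "b * c ^ m * gv = r * d" using d(2) by simp
  from lengths_cases[OF d(1)] show False
  proof (elim disjE exE)
    fix i' j' k' assume "d = gu * (a ^ i' * b ^ (2 * j') * c ^ k') \<and> (0 < k' \<longrightarrow> 0 < j')"
    then have d_eq: "d = gu * (a ^ i' * b ^ (2 * j') * c ^ k')" ..
    have "b * c ^ m * gv = a ^ i * b ^ (2 * j) * c ^ k * (gu * (a ^ i' * b ^ (2 * j') * c ^ k'))"
      unfolding len r_eq d_eq ..
    then have "gu ^ 0 * gv ^ 1 * a ^ 0 * b ^ 1 * c ^ m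
        = gu ^ 1 * gv ^ 0 * a ^ (i + i') * b ^ (2 * j + 2 * j') * c ^ (k + k')"
      by (simp only: power_add ac_simps power_0 power_one_right mult_1_left mult_1_right)
    from exponents[OF this] show False by simp
  next
    fix i' j' k' assume d_eq: "d = gv * (a ^ i' * b ^ (2 * j' + 1) * c ^ k')"
    have "b * c ^ m * gv = a ^ i * b ^ (2 * j) * c ^ k * (gv * (a ^ i' * b ^ (2 * j' + 1) * c ^ k'))"
      unfolding len r_eq d_eq ..
    then have "gu ^ 0 * gv ^ 1 * a ^ 0 * b ^ 1 * c ^ m
        = gu ^ 0 * gv ^ 1 * a ^ (i + i') * b ^ (2 * j + (2 * j' + 1)) * c ^ (k + k')"
      by (simp only: power_add ac_simps power_0 power_one_right mult_1_left mult_1_right)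
    from exponents[OF this] show False by (intro trivial) auto
  qed
qed

end

section \<open>Attractors of standard iterated function systems\<close>

theorem theorem7p5:
  fixes a g\<^sub>u b c g\<^sub>v s :: real and F\<^sub>u F\<^sub>v :: "real set"
  assumes "IFS2_params a g\<^sub>u b c g\<^sub>v"
    and "IFS2_attractors a g\<^sub>u b c g\<^sub>v F\<^sub>u F\<^sub>v"
    and "0 \<le> s" and "hausdorff_dim F\<^sub>u = ennreal s"
    and "hausdorff_measure s F\<^sub>v / hausdorff_measure s F\<^sub>u \<le> 1"
    and "(a + g\<^sub>u) * (1 - a powr s) / (b * a powr s) \<ge> 1"
    and "mult_rat_independent [g\<^sub>u, g\<^sub>v, a, b, c]"
  shows "\<not> (\<exists>n S. standard_IFS n S \<and> IFS_attractor n S F\<^sub>u)"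
proof (intro notI, elim exE conjE)
  fix n S assume S: "standard_IFS n S" "IFS_attractor n S F\<^sub>u"
  have params: "0 < a" "0 < g\<^sub>u" "0 < b" "0 < c" "0 < g\<^sub>v" "a + g\<^sub>u + b = 1" "c + g\<^sub>v + b = 1"
    using assms(1) by (auto simp: IFS2_params_def)
  have offset: "a + g\<^sub>u = 1 - b" "c + g\<^sub>v = 1 - b" using params by auto
  have maps: "S_e1 a = (\<lambda>x. a * x)" "S_e2 a g\<^sub>u b = (\<lambda>x. b * x + (1 - b))"
    "S_e3 c = (\<lambda>x. c * x)" "S_e4 b c g\<^sub>v = (\<lambda>x. b * x + (1 - b))"
    by (simp_all add: fun_eq_iff S_e1_def S_e2_def S_e3_def S_e4_def add.assoc offset)
  have attr: "compact F\<^sub>u" "compact F\<^sub>v" "F\<^sub>u \<noteq> {}" "F\<^sub>v \<noteq> {}"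
    "F\<^sub>u = (\<lambda>x. a * x) ` F\<^sub>u \<union> (\<lambda>x. b * x + (1 - b)) ` F\<^sub>v"
    "F\<^sub>v = (\<lambda>x. c * x) ` F\<^sub>v \<union> (\<lambda>x. b * x + (1 - b)) ` F\<^sub>u"
    using assms(2) unfolding IFS2_attractors_def maps by - (elim conjE, assumption)+
  interpret two_vertex_IFS a g\<^sub>u b c g\<^sub>v F\<^sub>u F\<^sub>v
    by unfold_locales (fact params attr)+
  note H = measure_positive_finite_at_dim[OF assms(3,4)]
  have union: "F\<^sub>u = (\<Union>i\<in>{1..n}. S i ` F\<^sub>u)"
    using S(2) unfolding IFS_attractor_def by blast
  then obtain i where i: "i \<in> {1..n}" "1 - b \<in> S i ` F\<^sub>u"
    using right_end_in_u by blast
  have sub: "S i ` F\<^sub>u \<subseteq> F\<^sub>u"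
    using union i(1) by blast
  obtain r where r: "0 < r" "r < 1" "\<And>x y. dist (S i x) (S i y) = r * dist x y"
    using S(1) i(1) unfolding standard_IFS_def contracting_similarity_def by blast
  obtain \<alpha> where "\<alpha> \<in> F\<^sub>u" "\<alpha> + r \<in> F\<^sub>u" "S i ` F\<^sub>u = F\<^sub>u \<inter> {\<alpha>..\<alpha> + r}"
    using similar_copy_is_interval_part[OF H(1,3,4,5) interval_density[OF assms(3-6)] r(3,1) sub]
    by blast
  then show False
    using similar_interval_part_avoids_right_piece[OF assms(7) r(3,1,2)] i(2) by blast
qed

end
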